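(* Let $M,E\in\mathcal{K}^n$ with $\dim(E)=n$, and let $K=M+E$ (Minkowski sum). Then, for every choice of integers $0\leq i<j<k\leq n$, $$(k-j)\,\mathrm{W}_{i}(K;E)+(i-k)\,\mathrm{W}_{j}(K;E)+(j-i)\,\mathrm{W}_{k}(K;E)\geq 0.$$ Equality holds if and only if $\dim(M)\leq 1$.
   Context: $\mathcal{K}^n$ denotes the set of all convex bodies in $\mathbb{R}^n$, i.e., all non-empty compact convex subsets of $\mathbb{R}^n$. The dimension $\dim(\cdot)$ of a convex body is the dimension of its affine hull. For $K,E\in\mathcal{K}^n$, the relative quermassintegrals $\mathrm{W}_i(K;E)$, $0\leq i\leq n$, are the coefficients defined by the relative Steiner formula $\mathrm{vol}(K+\lambda E)=\sum_{i=0}^n\binom{n}{i}\mathrm{W}_i(K;E)\lambda^i$ for all $\lambda\geq 0$, where $\mathrm{vol}$ is Lebesgue measure and $+$ is Minkowski addition; that is, $\mathrm{W}_i(K;E)$ is the mixed volume with $K$ appearing $n-i$ times and $E$ appearing $i$ times. *)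

theory Defs
  imports "HOL-Analysis.Analysis" "HOL-Library.Set_Algebras"
begin

definition convex_body :: "'a::euclidean_space set \<Rightarrow> bool" where
  "convex_body K \<longleftrightarrow> K \<noteq> {} \<and> compact K \<and> convex K"

text \<open>
  The coefficient families \<open>w\<close> for which the relative Steiner formula of \<open>K\<close> and \<open>E\<close> holds.
  The values of \<open>w\<close> at indices above the dimension do not enter the formula; they are fixed
  to be 0 so that \<open>w\<close> is determined as a function on the natural numbers.
  \<open>A + B\<close> is the Minkowski sum of the sets \<open>A\<close> and \<open>B\<close>.
\<close>

definition steiner_coeffs ::
    "'a::euclidean_space set \<Rightarrow> 'a set \<Rightarrow> (nat \<Rightarrow> real) \<Rightarrow> bool" where
  "steiner_coeffs K E w \<longleftrightarrow>
     (\<forall>i>DIM('a). w i = 0) \<and>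
     (\<forall>t\<ge>0. measure lebesgue (K + (\<lambda>x. t *\<^sub>R x) ` E) =
        (\<Sum>i\<le>DIM('a). real (DIM('a) choose i) * w i * t ^ i))"

lemma steiner_coeffs_unique:
  fixes K E :: "'a::euclidean_space set"
  assumes v: "steiner_coeffs K E v" and w: "steiner_coeffs K E w"
  shows "v = w"
proof (rule ext)
  fix i
  let ?n = "DIM('a)"
  define c where "c = (\<lambda>i. real (?n choose i) * (v i - w i))"
  have eq: "(\<Sum>i\<le>?n. c i * t ^ i) = 0" if "t \<ge> 0" for t
  proof -
    have "(\<Sum>i\<le>?n. real (?n choose i) * v i * t ^ i) =
          (\<Sum>i\<le>?n. real (?n choose i) * w i * t ^ i)"
      using v w that by (simp add: steiner_coeffs_def)
    then show ?thesis
      by (simp add: c_def algebra_simps sum_subtractf)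
  qed
  show "v i = w i"
  proof (cases "i \<le> ?n")
    case True
    have "infinite {t::real. 0 \<le> t}"
      using infinite_Ici by (metis atLeast_def)
    then have "infinite {t. (\<Sum>i\<le>?n. c i * t ^ i) = 0}"
      using eq by (metis (mono_tags, lifting) Collect_mono infinite_super)
    then have "c i = 0"
      using True polyfun_finite_roots[of c ?n] by blast
    with True show ?thesis by (simp add: c_def)
  next
    case False
    with v w show ?thesis by (simp add: steiner_coeffs_def)
  qed
qed

definition quermass :: "nat \<Rightarrow> 'a::euclidean_space set \<Rightarrow> 'a set \<Rightarrow> real" where
  "quermass i K E = (THE w. steiner_coeffs K E w) i"

end

theory Submission imports Defs begin

text \<open>
  Let \<open>p\<close> be a dense sequence in \<open>M\<close>. The gradient of \<open>x \<mapsto> ln (\<Sum>k. 2^-k exp (x \<bullet> p k))\<close> is the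
  mean of the \<open>p k\<close> under the exponentially tilted weights, hence lies in \<open>M\<close>, and its derivative
  \<open>A x\<close> is the covariance of the \<open>p k\<close> under these weights. With \<open>B x\<close> the covariance for \<open>E\<close>, the sum of
  the gradient maps for \<open>M\<close> and \<open>t E\<close> is a diffeomorphism onto \<open>M + t E\<close> up to the boundary (Gromov), so
  \<open>vol (M + t E) = \<integral> det (A x + t B x) dx\<close> for \<open>t > 0\<close>. Diagonalising \<open>A x\<close> and \<open>B x\<close> simultaneously, the
  integrand is \<open>C \<Prod>i. (\<lambda> i + t)\<close> with \<open>C > 0\<close> and \<open>\<lambda> i \<ge> 0\<close>, and at least two \<open>\<lambda> i\<close> are positive iff
  \<open>dim M \<ge> 2\<close>. Therefore \<open>vol (M + t E) = \<Sum>l. D l * t^(n - l)\<close> with \<open>D l \<ge> 0\<close>, where \<open>D 2 > 0\<close> if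
  \<open>dim M \<ge> 2\<close> and \<open>D l = 0\<close> for all \<open>l \<ge> 2\<close> otherwise. As \<open>K + t E = M + (1 + t) E\<close>, the \<open>i\<close>-th
  quermassintegral of \<open>K\<close> is \<open>\<Sum>l. D l * (n - i choose l) / (n choose l)\<close>, and the inequality is the
  convexity of \<open>x \<mapsto> (x choose l)\<close>, which is affine for \<open>l \<le> 1\<close> and strictly convex for \<open>l = 2\<close>.
\<close>

section \<open>Exponentially tilted means\<close>

text \<open>The factors \<open>(1/2)^k\<close> make the series converge for bounded \<open>p\<close>
  and \<open>c\<close> and give every \<open>p k\<close> positive weight. Coefficients separate from
  the exponents make directional derivatives of a tilt again tilts.\<close>

definition tilt :: "(nat \<Rightarrow> 'a::euclidean_space) \<Rightarrow> (nat \<Rightarrow> 'b::euclidean_space) \<Rightarrow> 'a \<Rightarrow> 'b" where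
  "tilt p c x = (\<Sum>k. ((1/2)^k * exp (x \<bullet> p k)) *\<^sub>R c k)"

definition tilt_mean :: "(nat \<Rightarrow> 'a::euclidean_space) \<Rightarrow> (nat \<Rightarrow> 'b::euclidean_space) \<Rightarrow> 'a \<Rightarrow> 'b" where
  "tilt_mean p c x = tilt p c x /\<^sub>R tilt p (\<lambda>_. 1::real) x"

text \<open>The tail is dominated by a geometric series. The explicit rate serves the uniform
  convergence needed for termwise differentiation.\<close>

lemma geometric_dominated_tail:
  fixes a :: "nat \<Rightarrow> 'b::euclidean_space"
  assumes a: "\<And>k. norm (a k) \<le> C * (1/2)^k"
  shows "summable a" and "norm (sum a {..<n} - suminf a) \<le> 2 * C * (1/2)^n"
proof -
  have g: "summable (\<lambda>k. C * (1/2)^k :: real)"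
    by (intro summable_mult summable_geometric) simp
  have sn: "summable (\<lambda>k. norm (a k))"
    by (rule summable_comparison_test'[OF g, of 0]) (use a in auto)
  then show s: "summable a" by (rule summable_norm_cancel)
  have sn': "summable (\<lambda>k. norm (a (k + n)))"
    using sn by (rule summable_ignore_initial_segment)
  have "norm (sum a {..<n} - suminf a) = norm (\<Sum>k. a (k + n))"
    using suminf_split_initial_segment[OF s, of n] by simp
  also have "\<dots> \<le> (\<Sum>k. norm (a (k + n)))"
    by (rule summable_norm[OF sn'])
  also have "\<dots> \<le> (\<Sum>k. C * (1/2)^n * (1/2)^k)"
  proof (rule suminf_le[OF _ sn'])
    show "norm (a (k + n)) \<le> C * (1/2)^n * (1/2)^k" for k
      using a[of "k + n"] by (simp add: power_add mult_ac)
    show "summable (\<lambda>k. C * (1/2)^n * (1/2)^k)"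
      by (intro summable_mult summable_geometric) simp
  qed
  also have "\<dots> = 2 * C * (1/2)^n"
    by (subst suminf_mult) (auto simp: suminf_geometric intro: summable_geometric)
  finally show "norm (sum a {..<n} - suminf a) \<le> 2 * C * (1/2)^n" .
qed

text \<open>Cauchy-Schwarz bounds the exponent by \<open>R * P\<close>; the bound depends on
  \<open>x\<close> only through \<open>R\<close>, so the domination is uniform on balls.\<close>

lemma tilt_term_bound:
  fixes p :: "nat \<Rightarrow> 'a::euclidean_space" and c :: "nat \<Rightarrow> 'b::euclidean_space"
  assumes p: "\<And>k. norm (p k) \<le> P" and c: "\<And>k. norm (c k) \<le> C"
    and x: "norm x \<le> R"
  shows "norm (((1/2)^k * exp (x \<bullet> p k)) *\<^sub>R c k) \<le> (exp (R * P) * C) * (1/2)^k"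
proof -
  have P: "P \<ge> 0" using p[of 0] norm_ge_zero order_trans by blast
  have "x \<bullet> p k \<le> norm x * norm (p k)" by (rule norm_cauchy_schwarz)
  also have "\<dots> \<le> R * P"
    using x p[of k] P by (intro mult_mono) (auto intro: order_trans[OF norm_ge_zero])
  finally have "exp (x \<bullet> p k) \<le> exp (R * P)" by simp
  then have "exp (x \<bullet> p k) * norm (c k) \<le> exp (R * P) * C"
    using c[of k] by (intro mult_mono) auto
  then show ?thesis by (simp add: mult_ac)
qed

lemma tilt_summable:
  fixes p :: "nat \<Rightarrow> 'a::euclidean_space" and c :: "nat \<Rightarrow> 'b::euclidean_space"
  assumes "bounded (range p)" "bounded (range c)"
  shows "summable (\<lambda>k. ((1/2)^k * exp (x \<bullet> p k)) *\<^sub>R c k)"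
proof -
  obtain P C where "\<And>k. norm (p k) \<le> P" "\<And>k. norm (c k) \<le> C"
    using assms unfolding bounded_iff by blast
  then have "norm (((1/2)^k * exp (x \<bullet> p k)) *\<^sub>R c k) \<le> (exp (norm x * P) * C) * (1/2)^k" for k
    by (intro tilt_term_bound) auto
  then show ?thesis by (rule geometric_dominated_tail(1))
qed

lemma bounded_range_inner:
  fixes p c :: "nat \<Rightarrow> 'a::real_inner"
  assumes "bounded (range p)" "bounded (range c)"
  shows "bounded (range (\<lambda>k. p k \<bullet> c k))"
proof -
  obtain P C where "\<And>k. norm (p k) \<le> P" "\<And>k. norm (c k) \<le> C"
    using assms unfolding bounded_iff by blast
  then have "norm (p k \<bullet> c k) \<le> P * C" for k
    using Cauchy_Schwarz_ineq2[of "p k" "c k"]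
    by (smt (verit) mult_mono norm_ge_zero real_norm_def)
  then show ?thesis unfolding bounded_iff by blast
qed

lemma bounded_range_scaleR:
  fixes c :: "nat \<Rightarrow> 'a::real_normed_vector" and r :: "nat \<Rightarrow> real"
  assumes "bounded (range r)" "bounded (range c)"
  shows "bounded (range (\<lambda>k. r k *\<^sub>R c k))"
proof -
  obtain P C where *: "\<And>k. norm (r k) \<le> P" "\<And>k. norm (c k) \<le> C"
    using assms unfolding bounded_iff by blast
  then have "norm (r k *\<^sub>R c k) \<le> P * C" for k
    by (simp, intro mult_mono) (auto intro: order_trans[OF norm_ge_zero] order_trans[OF abs_ge_zero])
  then show ?thesis unfolding bounded_iff by blast
qed

lemma bounded_range_const: "bounded (range (\<lambda>k. c))"
  by simp

lemma bounded_range_diff: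
  fixes c d :: "nat \<Rightarrow> 'a::real_normed_vector"
  assumes "bounded (range c)" "bounded (range d)"
  shows "bounded (range (\<lambda>k. c k - d k))"
proof -
  obtain P C where *: "\<And>k. norm (c k) \<le> P" "\<And>k. norm (d k) \<le> C"
    using assms unfolding bounded_iff by blast
  then have "norm (c k - d k) \<le> P + C" for k
    by (smt (verit) norm_triangle_ineq4)
  then show ?thesis unfolding bounded_iff by blast
qed

lemmas bounded_range_intros =
  bounded_range_const bounded_range_inner bounded_range_scaleR bounded_range_diff

text \<open>Termwise differentiation: direction \<open>h\<close> multiplies the \<open>k\<close>-th
  coefficient by \<open>h \<bullet> p k\<close>, and the differentiated series converges uniformly
  on a ball around \<open>x\<close>.\<close>

lemma tilt_has_derivative:
  fixes p :: "nat \<Rightarrow> 'a::euclidean_space" and c :: "nat \<Rightarrow> 'b::euclidean_space"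
  assumes p: "bounded (range p)" and c: "bounded (range c)"
  shows "(tilt p c has_derivative (\<lambda>h. tilt p (\<lambda>k. (h \<bullet> p k) *\<^sub>R c k) x)) (at x)"
proof -
  obtain P C where P: "\<And>k. norm (p k) \<le> P" and C: "\<And>k. norm (c k) \<le> C"
    using assms unfolding bounded_iff by blast
  have P0: "P \<ge> 0" and C0: "C \<ge> 0"
    using P[of 0] C[of 0] norm_ge_zero order_trans by blast+
  define R where "R = norm x + 1"
  define S where "S = ball (0::'a) R"
  have xS: "x \<in> S" by (simp add: S_def R_def)
  define D where "D = exp (R * P) * (P * C)"
  have D0: "D \<ge> 0" using P0 C0 by (simp add: D_def)
  have "\<exists>g. \<forall>x\<in>S. (\<lambda>k. ((1/2)^k * exp (x \<bullet> p k)) *\<^sub>R c k) sums g x \<and>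
      (g has_derivative (\<lambda>h. tilt p (\<lambda>k. (h \<bullet> p k) *\<^sub>R c k) x)) (at x within S)"
  proof (rule has_derivative_series)
    show "convex S" by (simp add: S_def)
    show "x \<in> S" by (rule xS)
    show "(\<lambda>k. ((1/2)^k * exp (x \<bullet> p k)) *\<^sub>R c k) sums tilt p c x"
      using tilt_summable[OF p c, of x] by (simp add: tilt_def summable_sums)
    show "((\<lambda>x. ((1/2)^k * exp (x \<bullet> p k)) *\<^sub>R c k) has_derivative
        (\<lambda>h. ((1/2)^k * exp (y \<bullet> p k)) *\<^sub>R ((h \<bullet> p k) *\<^sub>R c k))) (at y within S)" for k y
      by (rule derivative_eq_intros refl ext | simp)+
    show "\<forall>\<^sub>F n in sequentially. \<forall>x\<in>S. \<forall>h.
        norm ((\<Sum>k<n. ((1/2)^k * exp (x \<bullet> p k)) *\<^sub>R ((h \<bullet> p k) *\<^sub>R c k))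
          - tilt p (\<lambda>k. (h \<bullet> p k) *\<^sub>R c k) x) \<le> e * norm h" if e: "e > 0" for e
    proof -
      have "(\<lambda>n. 2 * D * (1/2)^n) \<longlonglongrightarrow> 2 * D * 0"
        by (intro tendsto_mult_left LIMSEQ_power_zero) simp
      then have "\<forall>\<^sub>F n in sequentially. 2 * D * (1/2)^n < e"
        using e by (auto dest: order_tendstoD)
      then show ?thesis
      proof eventually_elim
        case (elim n)
        show ?case
        proof (intro ballI allI)
          fix y h assume y: "y \<in> S"
          \<comment> \<open>The factor \<open>norm h\<close> comes out of the coefficients, so the
            error is small relative to \<open>norm h\<close>, uniformly in \<open>y\<close>.\<close>
          have h: "norm ((h \<bullet> p k) *\<^sub>R c k) \<le> norm h * (P * C)" for k
          proof -
            have "\<bar>h \<bullet> p k\<bar> \<le> norm h * P"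
              using Cauchy_Schwarz_ineq2[of h "p k"] P[of k]
              by (meson mult_left_mono norm_ge_zero order_trans)
            then have "\<bar>h \<bullet> p k\<bar> * norm (c k) \<le> (norm h * P) * C"
              using C[of k] P0 by (intro mult_mono) auto
            then show ?thesis by (simp add: mult_ac)
          qed
          have "norm (((1/2)^k * exp (y \<bullet> p k)) *\<^sub>R ((h \<bullet> p k) *\<^sub>R c k)) \<le>
              (exp (R * P) * (norm h * (P * C))) * (1/2)^k" for k
            using y by (intro tilt_term_bound P h) (simp add: S_def)
          from geometric_dominated_tail(2)[of "\<lambda>k. ((1/2)^k * exp (y \<bullet> p k)) *\<^sub>R ((h \<bullet> p k) *\<^sub>R c k)", OF this]
          have "norm ((\<Sum>k<n. ((1/2)^k * exp (y \<bullet> p k)) *\<^sub>R ((h \<bullet> p k) *\<^sub>R c k))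
              - tilt p (\<lambda>k. (h \<bullet> p k) *\<^sub>R c k) y) \<le> (2 * D * (1/2)^n) * norm h"
            unfolding tilt_def D_def by (simp only: mult_ac)
          also have "\<dots> \<le> e * norm h"
            using elim by (intro mult_right_mono) auto
          finally show "norm ((\<Sum>k<n. ((1/2)^k * exp (y \<bullet> p k)) *\<^sub>R ((h \<bullet> p k) *\<^sub>R c k))
              - tilt p (\<lambda>k. (h \<bullet> p k) *\<^sub>R c k) y) \<le> e * norm h" .
        qed
      qed
    qed
  qed
  then obtain g where g: "\<And>y. y \<in> S \<Longrightarrow> (\<lambda>k. ((1/2)^k * exp (y \<bullet> p k)) *\<^sub>R c k) sums g y"
      "\<And>y. y \<in> S \<Longrightarrow> (g has_derivative (\<lambda>h. tilt p (\<lambda>k. (h \<bullet> p k) *\<^sub>R c k) y)) (at y within S)"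
    by blast
  have "g y = tilt p c y" if "y \<in> S" for y
    using g(1)[OF that] by (simp add: tilt_def sums_iff)
  then have "(tilt p c has_derivative (\<lambda>h. tilt p (\<lambda>k. (h \<bullet> p k) *\<^sub>R c k) x)) (at x within S)"
    using g(2)[OF xS] xS by (metis (no_types, lifting) has_derivative_transform)
  then show ?thesis
    using at_within_open[OF xS] by (simp add: S_def)
qed

lemma tilt_pos:
  fixes p :: "nat \<Rightarrow> 'a::euclidean_space" and c :: "nat \<Rightarrow> real"
  assumes "bounded (range p)" "bounded (range c)" and "\<And>k. c k \<ge> 0" and "c m > 0"
  shows "tilt p c x > 0"
  unfolding tilt_def
  using tilt_summable[OF assms(1,2), of x] assms(3,4)
  by (intro suminf_pos2[of _ m]) auto

section \<open>Linearity and positivity of the weighted means\<close>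

lemma partition_function_pos:
  assumes "bounded (range p)"
  shows "tilt p (\<lambda>_. 1::real) x > 0"
  using assms by (intro tilt_pos[where m = 0]) auto

lemma tilt_mean_linear:
  fixes f :: "'b::euclidean_space \<Rightarrow> 'c::euclidean_space"
  assumes "linear f" and "bounded (range p)" "bounded (range c)"
  shows "tilt_mean p (\<lambda>k. f (c k)) x = f (tilt_mean p c x)"
proof -
  have f: "bounded_linear f" using assms(1) by (simp add: linear_conv_bounded_linear)
  have "f (tilt p c x) = tilt p (\<lambda>k. f (c k)) x"
    unfolding tilt_def bounded_linear.suminf[OF f tilt_summable[OF assms(2,3)]]
    using assms(1) by (simp add: linear_scale)
  then show ?thesis
    using assms(1) by (simp add: tilt_mean_def linear_scale)
qed

lemma tilt_mean_inner:
  assumes "bounded (range p)" "bounded (range c)"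
  shows "tilt_mean p (\<lambda>k. u \<bullet> c k) x = u \<bullet> tilt_mean p c x"
  by (rule tilt_mean_linear[OF bounded_linear.linear[OF bounded_linear_inner_right] assms])

lemma tilt_inner:
  assumes "bounded (range p)" "bounded (range c)"
  shows "tilt p (\<lambda>k. u \<bullet> c k) x = u \<bullet> tilt p c x"
  unfolding tilt_def bounded_linear.suminf[OF bounded_linear_inner_right tilt_summable[OF assms]]
  by simp

lemma tilt_mean_diff:
  fixes p :: "nat \<Rightarrow> 'a::euclidean_space" and c :: "nat \<Rightarrow> 'b::euclidean_space"
  assumes "bounded (range p)" "bounded (range c)" "bounded (range d)"
  shows "tilt_mean p (\<lambda>k. c k - d k) x = tilt_mean p c x - tilt_mean p d x"
  using suminf_diff[OF tilt_summable[OF assms(1,2)] tilt_summable[OF assms(1,3)], of x x]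
  by (simp add: tilt_mean_def tilt_def algebra_simps)

lemma tilt_mean_const:
  assumes "bounded (range p)"
  shows "tilt_mean p (\<lambda>_. c) x = c"
proof -
  have "tilt_mean p (\<lambda>_. c) x = tilt_mean p (\<lambda>_. 1::real) x *\<^sub>R c"
    using tilt_mean_linear[of "\<lambda>r::real. r *\<^sub>R c" p "\<lambda>_. 1" x] assms
    by (simp add: linear_scaleR_left)
  then show ?thesis
    using partition_function_pos[OF assms, of x] by (simp add: tilt_mean_def)
qed

text \<open>Every index carries positive weight, so a single positive value makes the mean
  positive.\<close>

lemma tilt_mean_nonneg:
  fixes c :: "nat \<Rightarrow> real"
  assumes "bounded (range p)" "bounded (range c)" "\<And>k. c k \<ge> 0"
  shows "tilt_mean p c x \<ge> 0"
    and "tilt_mean p c x = 0 \<longleftrightarrow> (\<forall>k. c k = 0)"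
proof -
  have pos: "tilt_mean p c x > 0" if "c m > 0" for m
    using tilt_pos[of p c m x] partition_function_pos[of p x] assms that
    by (simp add: tilt_mean_def)
  have zero: "tilt_mean p c x = 0" if "\<forall>k. c k = 0"
    using that by (simp add: tilt_mean_def tilt_def)
  show "tilt_mean p c x \<ge> 0"
  proof (cases "\<forall>k. c k = 0")
    case False
    then obtain m where "c m > 0" using assms(3) less_eq_real_def by metis
    then show ?thesis using pos by (simp add: less_imp_le)
  qed (simp add: zero)
  show "tilt_mean p c x = 0 \<longleftrightarrow> (\<forall>k. c k = 0)"
  proof
    assume "tilt_mean p c x = 0"
    then show "\<forall>k. c k = 0" using pos assms(3) by (metis less_eq_real_def less_irrefl)
  qed (rule zero)
qed

text \<open>The uncentred form of the covariance operator, as the quotient rule for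
  \<open>tilt_mean p p\<close> produces it.\<close>

definition tilt_cov :: "(nat \<Rightarrow> 'a::euclidean_space) \<Rightarrow> 'a \<Rightarrow> 'a \<Rightarrow> 'a" where
  "tilt_cov p x v = tilt_mean p (\<lambda>k. (v \<bullet> p k) *\<^sub>R p k) x - (v \<bullet> tilt_mean p p x) *\<^sub>R tilt_mean p p x"

lemma tilt_mean_has_derivative:
  fixes p :: "nat \<Rightarrow> 'a::euclidean_space"
  assumes p: "bounded (range p)"
  shows "(tilt_mean p p has_derivative tilt_cov p x) (at x)"
proof -
  let ?Z = "tilt p (\<lambda>_. 1::real)"
  have Z: "?Z x \<noteq> 0" using partition_function_pos[OF p, of x] by simp
  have h: "tilt p (\<lambda>k. h \<bullet> p k) x = h \<bullet> tilt p p x" for h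
    by (rule tilt_inner[OF p p])
  have "((\<lambda>x. inverse (?Z x) *\<^sub>R tilt p p x) has_derivative
     (\<lambda>v. inverse (?Z x) *\<^sub>R tilt p (\<lambda>k. (v \<bullet> p k) *\<^sub>R p k) x
        + - (inverse (?Z x) * tilt p (\<lambda>k. (v \<bullet> p k) *\<^sub>R 1) x * inverse (?Z x)) *\<^sub>R tilt p p x)) (at x)"
    by (rule has_derivative_scaleR[OF Deriv.has_derivative_inverse[OF Z tilt_has_derivative[OF p bounded_range_const]]
          tilt_has_derivative[OF p p]])
  moreover have "(\<lambda>v. inverse (?Z x) *\<^sub>R tilt p (\<lambda>k. (v \<bullet> p k) *\<^sub>R p k) x
        + - (inverse (?Z x) * tilt p (\<lambda>k. (v \<bullet> p k) *\<^sub>R 1) x * inverse (?Z x)) *\<^sub>R tilt p p x)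
        = tilt_cov p x"
    by (rule ext) (simp add: tilt_cov_def tilt_mean_def h)
  ultimately show ?thesis
    unfolding tilt_mean_def by simp
qed

text \<open>The centred form of the covariance, from which symmetry and semidefiniteness can be read
  off.\<close>

lemma inner_tilt_cov:
  fixes p :: "nat \<Rightarrow> 'a::euclidean_space"
  assumes p: "bounded (range p)"
  shows "u \<bullet> tilt_cov p x v = tilt_mean p
    (\<lambda>k. (u \<bullet> (p k - tilt_mean p p x)) * (v \<bullet> (p k - tilt_mean p p x))) x"
proof -
  define G where "G = tilt_mean p p x"
  have b: "bounded (range (\<lambda>k. (v \<bullet> p k) *\<^sub>R p k))"
    by (intro bounded_range_intros p)
  have mean: "tilt_mean p (\<lambda>k. w \<bullet> p k) x = w \<bullet> G" for w
    unfolding G_def by (rule tilt_mean_inner[OF p p])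
  have 1: "tilt_mean p (\<lambda>k. u \<bullet> ((v \<bullet> p k) *\<^sub>R p k)) x = u \<bullet> tilt_mean p (\<lambda>k. (v \<bullet> p k) *\<^sub>R p k) x"
    by (rule tilt_mean_inner[OF p b])
  \<comment> \<open>The product is expanded into its quadratic part minus one term that is affine in
    \<open>p k\<close>, whose mean is known.\<close>
  have "tilt_mean p (\<lambda>k. (u \<bullet> (p k - G)) * (v \<bullet> (p k - G))) x
    = tilt_mean p (\<lambda>k. (u \<bullet> ((v \<bullet> p k) *\<^sub>R p k)) -
        (((v \<bullet> G) *\<^sub>R u + (u \<bullet> G) *\<^sub>R v) \<bullet> p k - (u \<bullet> G) * (v \<bullet> G))) x"
    by (simp add: algebra_simps)
  also have "\<dots> = u \<bullet> tilt_mean p (\<lambda>k. (v \<bullet> p k) *\<^sub>R p k) x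
      - (((v \<bullet> G) *\<^sub>R u + (u \<bullet> G) *\<^sub>R v) \<bullet> G - (u \<bullet> G) * (v \<bullet> G))"
    by (simp add: tilt_mean_diff[OF p] tilt_mean_const[OF p] mean 1 bounded_range_intros p b
        del: inner_scaleR_right inner_add_left)
  also have "\<dots> = u \<bullet> tilt_cov p x v"
    by (simp add: tilt_cov_def G_def algebra_simps)
  finally show ?thesis by (simp add: G_def)
qed

lemma tilt_cov_sym:
  assumes "bounded (range p)"
  shows "u \<bullet> tilt_cov p x v = v \<bullet> tilt_cov p x u"
  by (simp add: inner_tilt_cov[OF assms] mult.commute)

lemma tilt_cov_linear:
  assumes "bounded (range p)"
  shows "linear (tilt_cov p x)"
  using tilt_mean_has_derivative[OF assms] has_derivative_linear by blast

text \<open>The form at \<open>v\<close> is the variance of \<open>v \<bullet> p k\<close>, which is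
  zero only if this is constant in \<open>k\<close>.\<close>

lemma tilt_cov_nonneg:
  assumes p: "bounded (range p)"
  shows "v \<bullet> tilt_cov p x v \<ge> 0"
    and "v \<bullet> tilt_cov p x v = 0 \<longleftrightarrow> (\<forall>k l. v \<bullet> p k = v \<bullet> p l)"
proof -
  let ?G = "tilt_mean p p x"
  have b: "bounded (range (\<lambda>k. (v \<bullet> (p k - ?G)) * (v \<bullet> (p k - ?G))))"
    using bounded_range_scaleR[of "\<lambda>k. v \<bullet> (p k - ?G)" "\<lambda>k. v \<bullet> (p k - ?G)"]
    by (simp add: bounded_range_intros p)
  show "v \<bullet> tilt_cov p x v \<ge> 0"
    unfolding inner_tilt_cov[OF p] by (rule tilt_mean_nonneg(1)[OF p b]) simp
  have "v \<bullet> tilt_cov p x v = 0 \<longleftrightarrow> (\<forall>k. v \<bullet> p k = v \<bullet> ?G)"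
    unfolding inner_tilt_cov[OF p] by (subst tilt_mean_nonneg(2)[OF p b]) (auto simp: inner_diff_right)
  also have "\<dots> \<longleftrightarrow> (\<forall>k l. v \<bullet> p k = v \<bullet> p l)"
  proof
    assume *: "\<forall>k l. v \<bullet> p k = v \<bullet> p l"
    have "v \<bullet> ?G = tilt_mean p (\<lambda>k. v \<bullet> p k) x"
      by (rule tilt_mean_inner[OF p p, symmetric])
    also have "\<dots> = tilt_mean p (\<lambda>k. v \<bullet> p 0) x"
      using * by metis
    also have "\<dots> = v \<bullet> p 0" by (rule tilt_mean_const[OF p])
    finally show "\<forall>k. v \<bullet> p k = v \<bullet> ?G" using * by metis
  qed simp
  finally show "v \<bullet> tilt_cov p x v = 0 \<longleftrightarrow> (\<forall>k l. v \<bullet> p k = v \<bullet> p l)" .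
qed

text \<open>A hyperplane separating the mean from \<open>K\<close> would give the nonnegative family
  \<open>a \<bullet> p k - b\<close> a negative mean.\<close>

lemma tilt_mean_in_closed_convex:
  assumes "range p \<subseteq> K" "bounded K" "closed K" "convex K"
  shows "tilt_mean p p x \<in> K"
proof (rule ccontr)
  assume "tilt_mean p p x \<notin> K"
  then obtain a b where ab: "a \<bullet> tilt_mean p p x < b" "\<And>y. y \<in> K \<Longrightarrow> a \<bullet> y > b"
    using separating_hyperplane_closed_point[OF assms(4,3)] by blast
  have p: "bounded (range p)" using assms bounded_subset by blast
  have "b \<le> a \<bullet> p k" for k
    using ab(2)[of "p k"] assms(1) by (simp add: image_subset_iff less_imp_le)
  then have "tilt_mean p (\<lambda>k. a \<bullet> p k - b) x \<ge> 0"
    using p by (intro tilt_mean_nonneg(1) bounded_range_intros) auto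
  moreover have "tilt_mean p (\<lambda>k. a \<bullet> p k - b) x = a \<bullet> tilt_mean p p x - b"
    by (simp add: tilt_mean_diff[OF p] tilt_mean_const[OF p] tilt_mean_inner[OF p] bounded_range_intros p)
  ultimately show False using ab(1) by simp
qed

section \<open>Gradient and growth of the log-partition function\<close>

lemma ln_partition_has_derivative:
  fixes p :: "nat \<Rightarrow> 'a::euclidean_space"
  assumes p: "bounded (range p)"
  shows "((\<lambda>x. ln (tilt p (\<lambda>_. 1::real) x)) has_derivative (\<lambda>h. h \<bullet> tilt_mean p p x)) (at x)"
proof -
  let ?Z = "tilt p (\<lambda>_. 1::real)"
  have Z: "?Z x > 0" using partition_function_pos[OF p, of x] by simp
  have h: "tilt p (\<lambda>k. h \<bullet> p k) x = h \<bullet> tilt p p x" for h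
    by (rule tilt_inner[OF p p])
  have "((\<lambda>x. ln (?Z x)) has_derivative (\<lambda>h. tilt p (\<lambda>k. (h \<bullet> p k) *\<^sub>R 1) x * inverse (?Z x))) (at x)"
    using tilt_has_derivative[OF p, of "\<lambda>_. 1::real" x] Z
    by (auto intro!: derivative_eq_intros simp: field_simps)
  moreover have "(\<lambda>h. tilt p (\<lambda>k. (h \<bullet> p k) *\<^sub>R 1) x * inverse (?Z x)) = (\<lambda>h. h \<bullet> tilt_mean p p x)"
    by (rule ext) (simp add: h tilt_mean_def)
  ultimately show ?thesis by simp
qed

lemma ln_partition_ge:
  fixes p :: "nat \<Rightarrow> 'a::euclidean_space"
  assumes p: "bounded (range p)"
  shows "ln (tilt p (\<lambda>_. 1::real) x) \<ge> x \<bullet> p k - real k * ln 2"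
proof -
  have "(1/2)^k * exp (x \<bullet> p k) \<le> tilt p (\<lambda>_. 1::real) x"
    unfolding tilt_def
    using sum_le_suminf[OF tilt_summable[OF p, of "\<lambda>_. 1::real" x], of "{k}"] by auto
  then have "ln ((1/2)^k * exp (x \<bullet> p k)) \<le> ln (tilt p (\<lambda>_. 1::real) x)"
    by (subst ln_le_cancel_iff) (auto intro: partition_function_pos p)
  then show ?thesis by (simp add: ln_mult ln_realpow ln_div)
qed

text \<open>Up to \<open>e * norm x\<close> and a constant, the log-partition function dominates the
  support function of \<open>K\<close>: finitely many \<open>p k\<close> form an
  \<open>e\<close>-net of \<open>K\<close>, so the loss \<open>k * ln 2\<close> of the single-term
  bound stays bounded.\<close>

lemma ln_partition_lower_bound:
  fixes p :: "nat \<Rightarrow> 'a::euclidean_space"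
  assumes K: "compact K" and p: "range p \<subseteq> K" and dense: "K \<subseteq> closure (range p)" and e: "e > 0"
  obtains C where "\<And>x y. y \<in> K \<Longrightarrow> ln (tilt p (\<lambda>_. 1::real) x) \<ge> x \<bullet> y - e * norm x - C"
proof -
  have bp: "bounded (range p)" using K p bounded_subset compact_imp_bounded by blast
  have "K \<subseteq> (\<Union>k\<in>UNIV. ball (p k) e)"
  proof
    fix y assume "y \<in> K"
    then have "y \<in> closure (range p)" using dense by blast
    then obtain z where "z \<in> range p" "dist z y < e"
      using e unfolding closure_approachable by blast
    then obtain k where "dist (p k) y < e" by blast
    then show "y \<in> (\<Union>k\<in>UNIV. ball (p k) e)" by auto
  qed
  then obtain F where F: "finite F" "K \<subseteq> (\<Union>k\<in>F. ball (p k) e)"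
    using compactE_image[OF K, of UNIV "\<lambda>k. ball (p k) e"] by auto
  obtain N where N: "\<And>k. k \<in> F \<Longrightarrow> k \<le> N"
    using F(1) finite_nat_set_iff_bounded_le by auto
  have "ln (tilt p (\<lambda>_. 1::real) x) \<ge> x \<bullet> y - e * norm x - real N * ln 2" if "y \<in> K" for x y
  proof -
    obtain k where k: "k \<in> F" "dist (p k) y < e" using F(2) \<open>y \<in> K\<close> by auto
    have "x \<bullet> y - x \<bullet> p k \<le> norm x * norm (y - p k)"
      using norm_cauchy_schwarz[of x "y - p k"] by (simp add: inner_diff_right)
    also have "\<dots> \<le> norm x * e"
      using k(2) by (intro mult_left_mono) (auto simp: dist_norm norm_minus_commute)
    finally have "x \<bullet> y - e * norm x \<le> x \<bullet> p k" by (simp add: mult.commute)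
    moreover have "real k * ln 2 \<le> real N * ln (2::real)" using N[OF k(1)] by simp
    ultimately show ?thesis using ln_partition_ge[OF bp, of x k] by linarith
  qed
  then show ?thesis using that by blast
qed

lemma dense_sequence_exists:
  fixes K :: "'a::euclidean_space set"
  assumes "K \<noteq> {}"
  obtains p :: "nat \<Rightarrow> 'a" where "range p \<subseteq> K" "K \<subseteq> closure (range p)"
proof -
  obtain T where T: "countable T" "T \<subseteq> K" "K \<subseteq> closure T"
    using separable by metis
  have "T \<noteq> {}" using T(3) assms by auto
  then have "range (from_nat_into T) = T" using T(1) by (rule range_from_nat_into)
  then show ?thesis using that T by metis
qed

section \<open>Pencils of positive semidefinite forms\<close>

text \<open>The expression has its minimum 0 at \<open>s = 0\<close>, so its derivative
  \<open>2 * b\<close> there is zero.\<close>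

lemma linear_coeff_zero_of_nonneg_quadratic:
  fixes b c :: real
  assumes "\<And>s. 0 \<le> 2 * s * b + s\<^sup>2 * c"
  shows "b = 0"
proof (rule ccontr)
  assume "b \<noteq> 0"
  \<comment> \<open>For either sign of \<open>c\<close> this gives \<open>0 < d\<close> and
    \<open>c < 2 * d\<close>, so \<open>s = - b / d\<close> makes the expression negative.\<close>
  define d where "d = \<bar>c\<bar> + 1"
  have d: "d > 0" "c < 2 * d" by (auto simp: d_def)
  have "2 * (- b / d) * b + (- b / d)\<^sup>2 * c = (b\<^sup>2 / d\<^sup>2) * (c - 2 * d)"
    using d by (simp add: power2_eq_square field_simps)
  also have "\<dots> < 0"
    using d \<open>b \<noteq> 0\<close> by (intro mult_pos_neg) auto
  finally show False using assms[of "- b / d"] by linarith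
qed

text \<open>The next vector is a maximiser of the ratio of the two quadratic forms on the
  \<open>B\<close>-orthogonal complement of the previous ones; the last conjunct says that this
  complement is also \<open>A\<close>-orthogonal to them.\<close>

lemma simultaneous_diagonal_sequence:
  fixes A B :: "'a::euclidean_space \<Rightarrow> 'a"
  assumes A: "linear A" "\<And>u v. u \<bullet> A v = v \<bullet> A u"
    and B: "linear B" "\<And>u v. u \<bullet> B v = v \<bullet> B u" "\<And>v. v \<noteq> 0 \<Longrightarrow> v \<bullet> B v > 0"
  assumes "k \<le> DIM('a)"
  shows "\<exists>v :: nat \<Rightarrow> 'a. (\<forall>i<k. \<forall>j<k. v i \<bullet> B (v j) = (if i = j then 1 else 0))
    \<and> (\<forall>i<k. \<forall>j<k. i \<noteq> j \<longrightarrow> v i \<bullet> A (v j) = 0)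
    \<and> (\<forall>u. (\<forall>i<k. u \<bullet> B (v i) = 0) \<longrightarrow> (\<forall>i<k. u \<bullet> A (v i) = 0))"
  using assms(6)
proof (induction k)
  case 0
  show ?case by simp
next
  case (Suc k)
  then have "k \<le> DIM('a)" by simp
  from Suc.IH[OF this] obtain v :: "nat \<Rightarrow> 'a"
    where vB: "\<forall>i<k. \<forall>j<k. v i \<bullet> B (v j) = (if i = j then 1 else 0)"
      and vA: "\<forall>i<k. \<forall>j<k. i \<noteq> j \<longrightarrow> v i \<bullet> A (v j) = 0"
      and vu: "\<forall>u. (\<forall>i<k. u \<bullet> B (v i) = 0) \<longrightarrow> (\<forall>i<k. u \<bullet> A (v i) = 0)"
    by (elim exE conjE) (rule that; assumption)
  define S where "S = {u. \<forall>i<k. u \<bullet> B (v i) = 0}"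
  have S_add: "u + w \<in> S" if "u \<in> S" "w \<in> S" for u w
    using that by (simp add: S_def inner_add_left)
  have S_scale: "c *\<^sub>R u \<in> S" if "u \<in> S" for u c
    using that by (simp add: S_def)
  have S_eq: "S = (\<Inter>i<k. {u. B (v i) \<bullet> u = 0})"
    by (auto simp: S_def inner_commute)
  have "closed S"
    unfolding S_eq by (intro closed_INT ballI closed_hyperplane)
  \<comment> \<open>The complement \<open>S\<close> is cut out by \<open>k < DIM('a)\<close> linear
    conditions, so it contains a nonzero vector.\<close>
  have "dim ((\<lambda>i. B (v i)) ` {..<k}) \<le> k"
    using dim_le_card'[of "(\<lambda>i. B (v i)) ` {..<k}"] card_image_le[of "{..<k}" "\<lambda>i. B (v i)"]
    by simp
  then have "dim ((\<lambda>i. B (v i)) ` {..<k}) < DIM('a)"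
    using Suc.prems by simp
  then obtain x where "x \<noteq> 0" "\<And>y. y \<in> span ((\<lambda>i. B (v i)) ` {..<k}) \<Longrightarrow> orthogonal x y"
    by (rule orthogonal_to_subspace_exists) blast
  then have x: "x \<noteq> 0" "x \<in> S"
    by (auto simp: S_def orthogonal_def span_base)
  \<comment> \<open>This Rayleigh quotient is invariant under scaling, so its maximum on the unit
    sphere of \<open>S\<close> bounds it on all nonzero vectors of \<open>S\<close>.\<close>
  let ?r = "\<lambda>u. (u \<bullet> A u) / (u \<bullet> B u)"
  have blA: "bounded_linear A" and blB: "bounded_linear B"
    using A(1) B(1) by (simp_all add: linear_conv_bounded_linear)
  have "compact (sphere 0 1 \<inter> S)"
    using \<open>closed S\<close> by (intro compact_Int_closed) auto
  moreover have "x /\<^sub>R norm x \<in> sphere 0 1 \<inter> S"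
    using x S_scale by simp
  moreover have "continuous_on (sphere 0 1 \<inter> S) ?r"
  proof (intro continuous_intros)
    show "continuous_on (sphere 0 1 \<inter> S) A" "continuous_on (sphere 0 1 \<inter> S) B"
      using blA blB by (simp_all add: linear_continuous_on)
    show "\<forall>u\<in>sphere 0 1 \<inter> S. u \<bullet> B u \<noteq> 0"
      using B(3) by (metis IntD1 less_irrefl norm_zero zero_neq_one mem_sphere_0)
  qed
  ultimately obtain m where m: "m \<in> sphere 0 1 \<inter> S" "\<And>u. u \<in> sphere 0 1 \<inter> S \<Longrightarrow> ?r u \<le> ?r m"
    using continuous_attains_sup[of "sphere 0 1 \<inter> S" ?r] by blast
  define mu where "mu = ?r m"
  have mS: "m \<in> S" and m0: "m \<noteq> 0" using m(1) by auto
  have Bm: "m \<bullet> B m > 0" using B(3) m0 by blast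
  have Am: "m \<bullet> A m = mu * (m \<bullet> B m)" using Bm by (simp add: mu_def)
  have max: "u \<bullet> A u \<le> mu * (u \<bullet> B u)" if "u \<in> S" for u
  proof (cases "u = 0")
    case True
    then show ?thesis by simp
  next
    case False
    have "u /\<^sub>R norm u \<in> sphere 0 1 \<inter> S" using False S_scale that by simp
    from m(2)[OF this] have "?r u \<le> mu"
      using False A(1) B(1) by (simp add: linear_scale mu_def)
    then show ?thesis using B(3)[OF False] by (simp add: divide_le_eq)
  qed
  \<comment> \<open>On \<open>S\<close> the form of \<open>mu * B - A\<close> is nonnegative and
    vanishes at \<open>m\<close>, hence its first variation at \<open>m\<close> is zero.\<close>
  have crit: "w \<bullet> A m = mu * (w \<bullet> B m)" if "w \<in> S" for w
  proof -
    have "mu * (w \<bullet> B m) - w \<bullet> A m = 0"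
    proof (rule linear_coeff_zero_of_nonneg_quadratic)
      fix s
      have "m + s *\<^sub>R w \<in> S" using mS that S_add S_scale by blast
      from max[OF this]
      show "0 \<le> 2 * s * (mu * (w \<bullet> B m) - w \<bullet> A m) + s\<^sup>2 * (mu * (w \<bullet> B w) - w \<bullet> A w)"
        using Am A(2)[of m w] B(2)[of m w] A(1) B(1)
        by (simp add: linear_add linear_scale inner_add_left inner_add_right power2_eq_square algebra_simps)
    qed
    then show ?thesis by simp
  qed
  define z where "z = m /\<^sub>R sqrt (m \<bullet> B m)"
  have zS: "z \<in> S" unfolding z_def by (rule S_scale[OF mS])
  have zB: "z \<bullet> B z = 1"
    using Bm B(1) by (simp add: z_def linear_scale field_simps)
  have zcrit: "w \<bullet> A z = mu * (w \<bullet> B z)" if "w \<in> S" for w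
    using crit[OF that] A(1) B(1) by (simp add: z_def linear_scale)
  have zv: "z \<bullet> B (v i) = 0" "v i \<bullet> B z = 0" "z \<bullet> A (v i) = 0" "v i \<bullet> A z = 0" if "i < k" for i
  proof -
    show *: "z \<bullet> B (v i) = 0" "z \<bullet> A (v i) = 0"
      using zS vu that by (auto simp: S_def)
    then show "v i \<bullet> B z = 0" "v i \<bullet> A z = 0"
      using A(2) B(2) by simp_all
  qed
  define v' where "v' = v(k := z)"
  show ?case
  proof (intro exI[of _ v'] conjI allI impI)
    fix i j assume "i < Suc k" "j < Suc k"
    then show "v' i \<bullet> B (v' j) = (if i = j then 1 else 0)"
      using vB zB zv by (auto simp: v'_def less_Suc_eq)
  next
    fix i j assume "i < Suc k" "j < Suc k" "i \<noteq> j"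
    then show "v' i \<bullet> A (v' j) = 0"
      using vA zv by (auto simp: v'_def less_Suc_eq)
  next
    fix u i assume u: "\<forall>i<Suc k. u \<bullet> B (v' i) = 0" and i: "i < Suc k"
    have uv: "u \<bullet> B (v j) = 0" if "j < k" for j
      using u that by (auto simp: v'_def less_Suc_eq split: if_splits)
    have "u \<bullet> B z = 0" using u by (auto simp: v'_def)
    then have "u \<bullet> A z = 0" using zcrit[of u] uv by (simp add: S_def)
    then show "u \<bullet> A (v' i) = 0"
      using vu uv i by (auto simp: v'_def less_Suc_eq)
  qed
qed

text \<open>The matrix has the vectors \<open>v j\<close> as columns, so the congruence yields the
  Gram matrix of the form of \<open>L\<close>.\<close>

lemma inner_eq_entry_congruence:
  fixes L :: "real^'n \<Rightarrow> real^'n" and v :: "'n \<Rightarrow> real^'n"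
  assumes "linear L"
  shows "(transpose (\<chi> i j. v j $ i) ** matrix L ** (\<chi> i j. v j $ i)) $ i $ j = v i \<bullet> L (v j)"
proof -
  let ?P = "(\<chi> i j. v j $ i) :: real^'n^'n"
  have "(transpose ?P ** matrix L ** ?P) $ i $ j = axis i 1 \<bullet> ((transpose ?P ** matrix L ** ?P) *v axis j 1)"
    by (simp add: inner_axis' matrix_vector_mul_component inner_axis)
  also have "\<dots> = axis i 1 \<bullet> (transpose ?P *v (matrix L *v (?P *v axis j 1)))"
    by (simp add: matrix_vector_mul_assoc matrix_mul_assoc)
  also have "\<dots> = (L (?P *v axis j 1) v* ?P) \<bullet> axis i 1"
    by (simp add: matrix_vector_mul(2)[OF assms] transpose_matrix_vector inner_commute[of "axis i 1"])
  also have "\<dots> = (?P *v axis i 1) \<bullet> L (?P *v axis j 1)"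
    by (simp only: dot_lmul_matrix) (rule inner_commute)
  also have "\<dots> = v i \<bullet> L (v j)"
    by (simp add: matrix_vector_mult_basis column_def)
  finally show ?thesis .
qed

text \<open>A full \<open>B\<close>-orthonormal and \<open>A\<close>-orthogonal family makes the
  congruent matrix of the pencil diagonal. Congruence multiplies the determinant by a square, whose
  reciprocal is \<open>C\<close>.\<close>

lemma simultaneous_diagonalization:
  fixes A B :: "real^'n \<Rightarrow> real^'n"
  assumes A: "linear A" "\<And>u v. u \<bullet> A v = v \<bullet> A u"
    and B: "linear B" "\<And>u v. u \<bullet> B v = v \<bullet> B u" "\<And>v. v \<noteq> 0 \<Longrightarrow> v \<bullet> B v > 0"
  obtains v :: "'n \<Rightarrow> real^'n" and C :: real where "C > 0"
    and "\<And>i j. v i \<bullet> B (v j) = (if i = j then 1 else 0)"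
    and "\<And>i j. i \<noteq> j \<Longrightarrow> v i \<bullet> A (v j) = 0"
    and "\<forall>u. (\<forall>i. v i \<bullet> u = 0) \<longrightarrow> u = 0"
    and "\<And>t. det (matrix (\<lambda>x. A x + t *\<^sub>R B x)) = C * (\<Prod>i\<in>UNIV. v i \<bullet> A (v i) + t)"
proof -
  obtain w :: "nat \<Rightarrow> real^'n"
    where w: "\<forall>i<CARD('n). \<forall>j<CARD('n). w i \<bullet> B (w j) = (if i = j then 1 else 0)"
      "\<forall>i<CARD('n). \<forall>j<CARD('n). i \<noteq> j \<longrightarrow> w i \<bullet> A (w j) = 0"
    using simultaneous_diagonal_sequence[OF A B(1,2), of "CARD('n)"] B(3) by auto
  obtain h :: "'n \<Rightarrow> nat" where h: "bij_betw h UNIV {..<CARD('n)}"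
    using finite_same_card_bij[of "UNIV :: 'n set" "{..<CARD('n)}"] by auto
  have hl: "h i < CARD('n)" for i using h by (auto simp: bij_betw_def)
  have hi: "h i = h j \<longleftrightarrow> i = j" for i j using h by (auto simp: bij_betw_def inj_on_def)
  define v where "v = (\<lambda>i. w (h i))"
  have vB: "v i \<bullet> B (v j) = (if i = j then 1 else 0)" for i j
    using w(1) hl hi by (simp add: v_def)
  have vA: "v i \<bullet> A (v j) = 0" if "i \<noteq> j" for i j
    using w(2) hl hi that by (simp add: v_def)
  let ?P = "(\<chi> i j. v j $ i) :: real^'n^'n"
  have cong: "(det ?P)\<^sup>2 * det (matrix (\<lambda>x. A x + t *\<^sub>R B x)) = (\<Prod>i\<in>UNIV. v i \<bullet> A (v i) + t)" for t
  proof -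
    let ?L = "\<lambda>x. A x + t *\<^sub>R B x"
    have L: "linear ?L"
      using A(1) B(1) by (intro linear_compose_add linear_compose_scale_right)
    have "(det ?P)\<^sup>2 * det (matrix ?L) = det (transpose ?P ** matrix ?L ** ?P)"
      by (simp add: det_mul det_transpose power2_eq_square)
    also have "\<dots> = (\<Prod>i\<in>UNIV. (transpose ?P ** matrix ?L ** ?P) $ i $ i)"
    proof (rule det_diagonal)
      fix i j :: 'n assume "i \<noteq> j"
      then show "(transpose ?P ** matrix ?L ** ?P) $ i $ j = 0"
        unfolding inner_eq_entry_congruence[OF L] by (simp add: inner_add_right vA vB)
    qed
    also have "\<dots> = (\<Prod>i\<in>UNIV. v i \<bullet> A (v i) + t)"
      unfolding inner_eq_entry_congruence[OF L] by (simp add: inner_add_right vB)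
    finally show ?thesis .
  qed
  \<comment> \<open>The congruence turns \<open>B\<close> into the identity, whose determinant is 1,
    so the family is a basis.\<close>
  have "det ?P \<noteq> 0"
  proof
    assume "det ?P = 0"
    have "(det ?P)\<^sup>2 * det (matrix B) = det (transpose ?P ** matrix B ** ?P)"
      by (simp add: det_mul det_transpose power2_eq_square)
    also have "\<dots> = (\<Prod>i\<in>UNIV. (transpose ?P ** matrix B ** ?P) $ i $ i)"
      by (rule det_diagonal) (simp only: inner_eq_entry_congruence[OF B(1)] vB if_False)
    also have "\<dots> = 1"
      unfolding inner_eq_entry_congruence[OF B(1)] by (simp add: vB)
    finally show False using \<open>det ?P = 0\<close> by simp
  qed
  then have pos: "(det ?P)\<^sup>2 > 0" by simp
  have inj: "u = 0" if "\<And>i. v i \<bullet> u = 0" for u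
  proof -
    have "transpose ?P *v u = 0"
      using that by (simp add: vec_eq_iff matrix_vector_mult_def transpose_def inner_vec_def)
    moreover have "invertible (transpose ?P)"
      using \<open>det ?P \<noteq> 0\<close> by (simp add: invertible_det_nz det_transpose)
    ultimately show ?thesis
      by (metis invertible_def matrix_left_invertible_ker)
  qed
  show thesis
  proof (rule that[of "1 / (det ?P)\<^sup>2" v])
    show "det (matrix (\<lambda>x. A x + t *\<^sub>R B x)) = 1 / (det ?P)\<^sup>2 * (\<Prod>i\<in>UNIV. v i \<bullet> A (v i) + t)" for t
      using cong[of t] pos by (simp add: field_simps)
  qed (use pos vA vB inj in auto)
qed

text \<open>A vector on which a nonnegative form vanishes is a minimiser, so the first variation in
  every direction \<open>u\<close> is zero.\<close>

lemma psd_kernel: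
  fixes A :: "'a::real_inner \<Rightarrow> 'a"
  assumes A: "linear A" "\<And>u v. u \<bullet> A v = v \<bullet> A u" "\<And>v. v \<bullet> A v \<ge> 0" and v: "v \<bullet> A v = 0"
  shows "u \<bullet> A v = 0"
proof (rule linear_coeff_zero_of_nonneg_quadratic)
  show "0 \<le> 2 * s * (u \<bullet> A v) + s\<^sup>2 * (u \<bullet> A u)" for s
    using A(3)[of "v + s *\<^sub>R u"] A(1) A(2)[of u v] v
    by (simp add: linear_add linear_scale inner_add_left inner_add_right power2_eq_square algebra_simps)
qed

text \<open>The \<open>l\<close>-th coefficient is a positive multiple of the \<open>l\<close>-th elementary symmetric
  function of the eigenvalues of \<open>A\<close> relative to \<open>B\<close>.\<close>

lemma det_pencil_coefficients:
  fixes A B :: "real^'n \<Rightarrow> real^'n"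
  assumes A: "linear A" "\<And>u v. u \<bullet> A v = v \<bullet> A u" "\<And>v. v \<bullet> A v \<ge> 0"
    and B: "linear B" "\<And>u v. u \<bullet> B v = v \<bullet> B u" "\<And>v. v \<noteq> 0 \<Longrightarrow> v \<bullet> B v > 0"
  obtains d :: "nat \<Rightarrow> real" where "\<And>l. d l \<ge> 0"
    and "\<And>t. det (matrix (\<lambda>x. A x + t *\<^sub>R B x)) = (\<Sum>l\<le>CARD('n). d l * t ^ (CARD('n) - l))"
    and "\<exists>w. \<forall>u. u \<bullet> w = 0 \<longrightarrow> u \<bullet> A u = 0 \<Longrightarrow> \<forall>l\<ge>2. d l = 0"
    and "\<nexists>w. \<forall>u. u \<bullet> w = 0 \<longrightarrow> u \<bullet> A u = 0 \<Longrightarrow> d 2 > 0"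
proof -
  obtain v :: "'n \<Rightarrow> real^'n" and C :: real where C: "C > 0"
    and vB: "\<And>i j. v i \<bullet> B (v j) = (if i = j then 1 else 0)"
    and vA: "\<And>i j. i \<noteq> j \<Longrightarrow> v i \<bullet> A (v j) = 0"
    and inj: "\<forall>u. (\<forall>i. v i \<bullet> u = 0) \<longrightarrow> u = 0"
    and det: "\<And>t. det (matrix (\<lambda>x. A x + t *\<^sub>R B x)) = C * (\<Prod>i\<in>UNIV. v i \<bullet> A (v i) + t)"
    by (rule simultaneous_diagonalization[OF A(1,2) B]; (assumption | (rule that; assumption)))
  define lam where "lam = (\<lambda>i. v i \<bullet> A (v i))"
  have lam: "lam i \<ge> 0" for i using A(3) by (simp add: lam_def)
  define d where "d = (\<lambda>l. C * (\<Sum>X | card X = l. \<Prod>i\<in>X. lam i))"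
  have d0: "d l \<ge> 0" for l
    unfolding d_def using C lam by (intro mult_nonneg_nonneg sum_nonneg prod_nonneg) auto
  have poly: "det (matrix (\<lambda>x. A x + t *\<^sub>R B x)) = (\<Sum>l\<le>CARD('n). d l * t ^ (CARD('n) - l))" for t
  proof -
    have "(\<Prod>i\<in>UNIV. lam i + t) = (\<Sum>X\<in>UNIV. (\<Prod>i\<in>X. lam i) * t ^ (CARD('n) - card X))"
      by (subst prod_add) (simp_all add: card_Diff_subset)
    also have "\<dots> = (\<Sum>l\<le>CARD('n). \<Sum>X | card X = l. (\<Prod>i\<in>X. lam i) * t ^ (CARD('n) - card X))"
      using sum.group[of "UNIV :: 'n set set" "{..CARD('n)}" card
          "\<lambda>X. (\<Prod>i\<in>X. lam i) * t ^ (CARD('n) - card X)"]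
      by (simp add: image_subset_iff card_mono)
    also have "\<dots> = (\<Sum>l\<le>CARD('n). (\<Sum>X | card X = l. \<Prod>i\<in>X. lam i) * t ^ (CARD('n) - l))"
      by (simp add: sum_distrib_right)
    finally show ?thesis
      using det[of t] by (simp add: lam_def d_def sum_distrib_left sum_distrib_right mult.assoc)
  qed
  have vanish: "\<forall>l\<ge>2. d l = 0" if "\<exists>w. \<forall>u. u \<bullet> w = 0 \<longrightarrow> u \<bullet> A u = 0"
  proof -
    obtain w where w: "\<And>u. u \<bullet> w = 0 \<Longrightarrow> u \<bullet> A u = 0" using \<open>\<exists>w. _ w\<close> by blast
    have unique: "lam i = 0 \<or> lam j = 0" if "i \<noteq> j" for i j
    proof -
      \<comment> \<open>A combination of \<open>v i\<close> and \<open>v j\<close> orthogonal to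
        \<open>w\<close>, with form a nonnegative combination of \<open>lam i\<close> and
        \<open>lam j\<close>. If the factor \<open>v j \<bullet> w\<close> is zero,
        \<open>v j\<close> itself gives \<open>lam j = 0\<close>.\<close>
      define u where "u = (v j \<bullet> w) *\<^sub>R v i - (v i \<bullet> w) *\<^sub>R v j"
      have "u \<bullet> w = 0" by (simp add: u_def inner_diff_left)
      then have "u \<bullet> A u = 0" by (rule w)
      moreover have "u \<bullet> A u = (v j \<bullet> w)\<^sup>2 * lam i + (v i \<bullet> w)\<^sup>2 * lam j"
        using A(1) vA that
        by (simp add: u_def lam_def linear_diff linear_scale inner_diff_left inner_diff_right power2_eq_square)
      ultimately have "(v j \<bullet> w)\<^sup>2 * lam i = 0"
        using lam by (metis add_nonneg_eq_0_iff mult_nonneg_nonneg zero_le_power2)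
      then show ?thesis using w[of "v j"] by (auto simp: lam_def)
    qed
    have "(\<Prod>i\<in>X. lam i) = 0" if X: "card X \<ge> 2" for X
    proof -
      obtain i j where "i \<in> X" "j \<in> X" "i \<noteq> j"
        using X card_2_iff' by (metis obtain_subset_with_card_n subset_iff)
      then show ?thesis using unique[of i j] by auto
    qed
    then show ?thesis
      unfolding d_def by (auto intro!: sum.neutral simp del: prod_zero_iff)
  qed
  have pos: "d 2 > 0" if not_line: "\<nexists>w. \<forall>u. u \<bullet> w = 0 \<longrightarrow> u \<bullet> A u = 0"
  proof -
    \<comment> \<open>Otherwise at most one eigenvalue, at some \<open>i0\<close>, is positive, and
      \<open>B (v i0)\<close> serves as a \<open>w\<close> that the assumption excludes.\<close>
    have "\<exists>i j. i \<noteq> j \<and> lam i > 0 \<and> lam j > 0"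
    proof (rule ccontr)
      assume *: "\<not> ?thesis"
      have "\<exists>i0. \<forall>j. j \<noteq> i0 \<longrightarrow> lam j = 0"
        using * lam by (metis less_eq_real_def)
      then obtain i0 where i0: "\<And>j. j \<noteq> i0 \<Longrightarrow> lam j = 0" by blast
      have "u \<bullet> A u = 0" if u: "u \<bullet> B (v i0) = 0" for u
      proof -
        \<comment> \<open>The difference is orthogonal to every \<open>v j\<close>: by
          \<open>psd_kernel\<close> if \<open>j\<close> is not \<open>i0\<close>, by normalisation
          otherwise. So \<open>A u\<close> is a multiple of \<open>B (v i0)\<close>.\<close>
        have "A u - (v i0 \<bullet> A u) *\<^sub>R B (v i0) = 0"
        proof (intro inj[rule_format] allI)
          fix j
          show "v j \<bullet> (A u - (v i0 \<bullet> A u) *\<^sub>R B (v i0)) = 0"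
          proof (cases "j = i0")
            case False
            then have "u \<bullet> A (v j) = 0"
              using psd_kernel[OF A] i0 unfolding lam_def by blast
            then show ?thesis using False A(2)[of u "v j"] by (simp add: inner_diff_right vB)
          qed (simp add: inner_diff_right vB)
        qed
        then have "A u = (v i0 \<bullet> A u) *\<^sub>R B (v i0)" by simp
        then show ?thesis using u by (metis inner_scaleR_right mult_zero_right)
      qed
      with not_line show False by blast
    qed
    then obtain i j where ij: "i \<noteq> j" "lam i > 0" "lam j > 0" by blast
    have "(\<Prod>i\<in>{i, j}. lam i) \<le> (\<Sum>X | card X = 2. \<Prod>i\<in>X. lam i)"
      using ij lam by (intro member_le_sum) (auto intro: prod_nonneg)
    moreover have "(\<Prod>i\<in>{i, j}. lam i) > 0" using ij by simp
    ultimately show ?thesis using C by (simp add: d_def)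
  qed
  show thesis using that[of d] d0 poly vanish pos by blast
qed

section \<open>The gradient map onto the Minkowski sum\<close>

lemma set_plus_scaled_eq_image:
  fixes M E :: "'a::real_normed_vector set"
  shows "M + (\<lambda>x. t *\<^sub>R x) ` E = (\<lambda>(x, y). x + t *\<^sub>R y) ` (M \<times> E)"
  by (force simp: set_plus_def)

lemma compact_set_plus_scaled:
  fixes M E :: "'a::real_normed_vector set"
  assumes "compact M" "compact E"
  shows "compact (M + (\<lambda>x. t *\<^sub>R x) ` E)"
  unfolding set_plus_scaled_eq_image case_prod_beta
  by (intro compact_continuous_image compact_Times assms continuous_intros)

lemma convex_set_plus_scaled:
  fixes M E :: "'a::real_normed_vector set"
  assumes "convex M" "convex E"
  shows "convex (M + (\<lambda>x. t *\<^sub>R x) ` E)"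
  using assms by (intro convex_set_plus convex_scaling) auto

lemma tilt_sum_range_subset:
  assumes M: "convex M" "compact M" "range p \<subseteq> M" and E: "convex E" "compact E" "range q \<subseteq> E"
  shows "range (\<lambda>x. tilt_mean p p x + t *\<^sub>R tilt_mean q q x) \<subseteq> M + (\<lambda>x. t *\<^sub>R x) ` E"
proof -
  have "tilt_mean p p x \<in> M" "tilt_mean q q x \<in> E" for x
    using M E by (auto intro!: tilt_mean_in_closed_convex compact_imp_bounded compact_imp_closed)
  then show ?thesis by (auto intro!: set_plus_intro)
qed

text \<open>For \<open>y\<close> in the interior, the potential minus \<open>y\<close> is coercive; its gradient vanishes at
  a minimiser.\<close>

lemma interior_subset_tilt_sum_range:
  fixes p q :: "nat \<Rightarrow> 'a::euclidean_space"
  assumes M: "compact M" "range p \<subseteq> M" "M \<subseteq> closure (range p)"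
    and E: "compact E" "range q \<subseteq> E" "E \<subseteq> closure (range q)" and t: "t > 0"
  shows "interior (M + (\<lambda>x. t *\<^sub>R x) ` E) \<subseteq> range (\<lambda>x. tilt_mean p p x + t *\<^sub>R tilt_mean q q x)"
proof
  fix y assume "y \<in> interior (M + (\<lambda>x. t *\<^sub>R x) ` E)"
  then obtain r where r: "r > 0" "cball y r \<subseteq> M + (\<lambda>x. t *\<^sub>R x) ` E"
    unfolding mem_interior_cball by blast
  have p: "bounded (range p)" and q: "bounded (range q)"
    using M E bounded_subset compact_imp_bounded by blast+
  \<comment> \<open>The losses \<open>e * norm x\<close> and \<open>t * e * norm x\<close> then add
    up to half of the gain \<open>r * norm x\<close>.\<close>
  define e where "e = r / (2 * (1 + t))"
  have e: "e > 0" "e * (1 + t) = r / 2" using r t by (simp_all add: e_def field_simps)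
  let ?f = "\<lambda>x. ln (tilt p (\<lambda>_. 1::real) x)" and ?g = "\<lambda>x. ln (tilt q (\<lambda>_. 1::real) x)"
  obtain C where C: "\<And>x m. m \<in> M \<Longrightarrow> ?f x \<ge> x \<bullet> m - e * norm x - C"
    by (rule ln_partition_lower_bound[OF M e(1)]) blast
  obtain D where D: "\<And>x m. m \<in> E \<Longrightarrow> ?g x \<ge> x \<bullet> m - e * norm x - D"
    by (rule ln_partition_lower_bound[OF E e(1)]) blast
  define h where "h = (\<lambda>x. ?f x + t * ?g x - x \<bullet> y)"
  have coercive: "h x \<ge> r / 2 * norm x - (C + t * D)" for x
  proof -
    \<comment> \<open>The vector of length \<open>r\<close> in the direction of \<open>x\<close>;
      for \<open>x = 0\<close> the quotient is 0 and so is \<open>u\<close>.\<close>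
    define u where "u = (r / norm x) *\<^sub>R x"
    have u: "x \<bullet> u = r * norm x" "norm u \<le> r"
      using r by (auto simp: u_def power2_norm_eq_inner[symmetric] power2_eq_square)
    have "y + u \<in> cball y r" using u by (simp add: dist_norm)
    then obtain m b where mb: "m \<in> M" "b \<in> E" "y + u = m + t *\<^sub>R b"
      using r(2) by (auto simp: set_plus_def)
    have "t * ?g x \<ge> t * (x \<bullet> b - e * norm x - D)"
      using D[OF mb(2), of x] t by (intro mult_left_mono) auto
    then have "h x \<ge> x \<bullet> (m + t *\<^sub>R b) - (e * (1 + t)) * norm x - (C + t * D) - x \<bullet> y"
      using C[OF mb(1), of x] by (simp add: h_def inner_add_right algebra_simps)
    then show ?thesis
      unfolding mb(3)[symmetric] e(2) using u(1) by (simp add: inner_add_right)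
  qed
  have deriv: "(h has_derivative (\<lambda>v. v \<bullet> tilt_mean p p x + t * (v \<bullet> tilt_mean q q x) - v \<bullet> y)) (at x)" for x
    unfolding h_def
    by (intro has_derivative_diff has_derivative_add has_derivative_mult_right
        ln_partition_has_derivative p q has_derivative_inner_left has_derivative_ident)
  then have cont: "continuous_on S h" for S
    by (meson continuous_at_imp_continuous_on has_derivative_continuous)
  \<comment> \<open>Outside the ball of radius \<open>R\<close> the coercive bound exceeds
    \<open>h 0\<close>, so a minimiser over the ball is global; the maximum with 0 keeps the ball
    nonempty.\<close>
  define R where "R = max 0 ((h 0 + (C + t * D)) * 2 / r)"
  have "R \<ge> 0" by (simp add: R_def)
  then have "cball (0::'a) R \<noteq> {}" by simp
  from continuous_attains_inf[OF compact_cball this cont]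
  obtain x where x: "\<And>z. z \<in> cball 0 R \<Longrightarrow> h x \<le> h z" by blast
  have min: "h x \<le> h z" for z
  proof (cases "z \<in> cball 0 R")
    case False
    then have "norm z > (h 0 + (C + t * D)) * 2 / r" by (simp add: R_def)
    then have "h 0 < r / 2 * norm z - (C + t * D)" using r(1) by (simp add: field_simps)
    also have "\<dots> \<le> h z" by (rule coercive)
    finally show ?thesis using x[of 0] \<open>R \<ge> 0\<close> by simp
  qed (rule x)
  have "(\<lambda>v. v \<bullet> tilt_mean p p x + t * (v \<bullet> tilt_mean q q x) - v \<bullet> y) = (\<lambda>v. 0)"
    by (rule differential_zero_maxmin[OF UNIV_I open_UNIV deriv]) (use min in auto)
  then have "v \<bullet> (tilt_mean p p x + t *\<^sub>R tilt_mean q q x - y) = 0" for v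
    by (simp add: inner_diff_right inner_add_right fun_eq_iff)
  then have "tilt_mean p p x + t *\<^sub>R tilt_mean q q x - y = 0"
    using inner_eq_zero_iff by blast
  then have "y = tilt_mean p p x + t *\<^sub>R tilt_mean q q x" by simp
  then show "y \<in> range (\<lambda>x. tilt_mean p p x + t *\<^sub>R tilt_mean q q x)" by blast
qed

text \<open>With \<open>v = y - x\<close>, the function \<open>v \<bullet> F\<close> is strictly
  increasing along the segment from \<open>x\<close> to \<open>y\<close>.\<close>

lemma inj_of_positive_derivative:
  fixes F :: "'a::real_inner \<Rightarrow> 'a"
  assumes F: "\<And>x. (F has_derivative F' x) (at x)" and pos: "\<And>x v. v \<noteq> 0 \<Longrightarrow> v \<bullet> F' x v > 0"
  shows "inj F"
proof (rule injI, rule ccontr)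
  fix x y assume eq: "F x = F y" and "x \<noteq> y"
  define v where "v = y - x"
  have v: "v \<noteq> 0" using \<open>x \<noteq> y\<close> by (simp add: v_def)
  have "((\<lambda>s. v \<bullet> F (x + s *\<^sub>R v)) has_derivative (\<lambda>h. v \<bullet> F' (x + s *\<^sub>R v) (h *\<^sub>R v))) (at s)" for s
    by (intro has_derivative_inner_right has_derivative_compose[OF _ F]) (auto intro!: derivative_eq_intros)
  moreover have "v \<bullet> F' (x + s *\<^sub>R v) (h *\<^sub>R v) = (v \<bullet> F' (x + s *\<^sub>R v) v) * h" for s h
    using has_derivative_linear[OF F[of "x + s *\<^sub>R v"]] by (simp add: linear_scale)
  ultimately have "((\<lambda>s. v \<bullet> F (x + s *\<^sub>R v)) has_real_derivative v \<bullet> F' (x + s *\<^sub>R v) v) (at s)" for s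
    by (simp add: has_field_derivative_def)
  then have "v \<bullet> F (x + 0 *\<^sub>R v) < v \<bullet> F (x + 1 *\<^sub>R v)"
    using pos[OF v] by (intro DERIV_pos_imp_increasing[of 0 1 "\<lambda>s. v \<bullet> F (x + s *\<^sub>R v)"]) auto
  then show False using eq by (simp add: v_def)
qed

section \<open>Dimension of a body in terms of its constant functionals\<close>

lemma inner_const_on_dense:
  fixes p :: "nat \<Rightarrow> 'a::euclidean_space"
  assumes "range p \<subseteq> M" "M \<subseteq> closure (range p)"
  shows "(\<forall>k l. v \<bullet> p k = v \<bullet> p l) \<longleftrightarrow> (\<forall>x\<in>M. \<forall>y\<in>M. v \<bullet> x = v \<bullet> y)"
proof
  assume *: "\<forall>k l. v \<bullet> p k = v \<bullet> p l"
  have "range p \<subseteq> {x. v \<bullet> x = v \<bullet> p 0}" using * by auto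
  then have "closure (range p) \<subseteq> {x. v \<bullet> x = v \<bullet> p 0}"
    by (intro closure_minimal closed_hyperplane)
  then have "v \<bullet> x = v \<bullet> p 0" if "x \<in> M" for x using assms(2) that by blast
  then show "\<forall>x\<in>M. \<forall>y\<in>M. v \<bullet> x = v \<bullet> y" by simp
qed (use assms(1) in \<open>simp add: image_subset_iff\<close>)

lemma full_aff_dim_inner_const:
  fixes E :: "'a::euclidean_space set"
  assumes "aff_dim E = int DIM('a)" and "\<forall>x\<in>E. \<forall>y\<in>E. v \<bullet> x = v \<bullet> y"
  shows "v = 0"
proof (rule ccontr)
  assume v: "v \<noteq> 0"
  have "E \<noteq> {}" using assms(1) by auto
  then obtain e where "e \<in> E" by blast
  then have "E \<subseteq> {x. v \<bullet> x = v \<bullet> e}" using assms(2) by blast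
  then have "aff_dim E \<le> int DIM('a) - 1"
    using aff_dim_subset[of E "{x. v \<bullet> x = v \<bullet> e}"] aff_dim_hyperplane[OF v] by simp
  then show False using assms(1) by simp
qed

text \<open>Full dimension of \<open>E\<close> enters here: a nonzero functional is not constant on
  \<open>E\<close>, so its variance is positive.\<close>

lemma tilt_cov_pos:
  fixes q :: "nat \<Rightarrow> 'a::euclidean_space"
  assumes E: "compact E" "range q \<subseteq> E" "E \<subseteq> closure (range q)" "aff_dim E = int DIM('a)"
    and "v \<noteq> 0"
  shows "v \<bullet> tilt_cov q x v > 0"
proof -
  have q: "bounded (range q)"
    using E bounded_subset compact_imp_bounded by blast
  have "v \<bullet> tilt_cov q x v \<noteq> 0"
    using full_aff_dim_inner_const[OF E(4)] \<open>v \<noteq> 0\<close>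
    unfolding tilt_cov_nonneg(2)[OF q] inner_const_on_dense[OF E(2,3)] by blast
  then show ?thesis using tilt_cov_nonneg(1)[OF q, of v x] by linarith
qed

text \<open>A set lies on a line of direction \<open>w\<close> when the functionals vanishing at
  \<open>w\<close> are constant on it; \<open>w = 0\<close> covers a single point. This form matches
  the degeneracy condition on the covariance.\<close>

lemma aff_dim_le_1_iff:
  fixes M :: "'a::euclidean_space set"
  assumes "M \<noteq> {}"
  shows "aff_dim M \<le> 1 \<longleftrightarrow> (\<exists>w. \<forall>u. u \<bullet> w = 0 \<longrightarrow> (\<forall>x\<in>M. \<forall>y\<in>M. u \<bullet> x = u \<bullet> y))"
proof -
  obtain m where m: "m \<in> M" using assms by blast
  define D where "D = (+) (- m) ` M"
  have dim: "aff_dim M = int (dim D)"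
    unfolding D_def using m by (intro aff_dim_eq_dim) (simp add: hull_inc)
  show ?thesis
  proof
    assume "aff_dim M \<le> 1"
    then have "dim D \<le> 1" using dim by simp
    obtain B where B: "B \<subseteq> D" "independent B" "D \<subseteq> span B" "card B = dim D"
      using basis_exists by blast
    have "finite B" using B(2) by (rule independent_imp_finite)
    have "\<exists>w. B \<subseteq> {w}"
    proof (cases "B = {}")
      case False
      then obtain w where "w \<in> B" by blast
      moreover have "\<forall>x\<in>B. \<forall>y\<in>B. x = y"
        using B(4) \<open>dim D \<le> 1\<close> card_le_Suc0_iff_eq[OF \<open>finite B\<close>] by simp
      ultimately show ?thesis by blast
    qed simp
    then obtain w where "D \<subseteq> span {w}"
      using B(3) span_mono by blast
    have "u \<bullet> x = u \<bullet> m" if "u \<bullet> w = 0" "x \<in> M" for u x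
    proof -
      have "x - m \<in> D" unfolding D_def using that(2) by (auto intro!: image_eqI[of _ _ x])
      then obtain c where "x - m = c *\<^sub>R w"
        using \<open>D \<subseteq> span {w}\<close> by (auto simp: span_singleton)
      then have "u \<bullet> (x - m) = 0" using that(1) by simp
      then show ?thesis by (simp add: inner_diff_right)
    qed
    then show "\<exists>w. \<forall>u. u \<bullet> w = 0 \<longrightarrow> (\<forall>x\<in>M. \<forall>y\<in>M. u \<bullet> x = u \<bullet> y)" by metis
  next
    assume "\<exists>w. \<forall>u. u \<bullet> w = 0 \<longrightarrow> (\<forall>x\<in>M. \<forall>y\<in>M. u \<bullet> x = u \<bullet> y)"
    then obtain w where w: "\<And>u x y. u \<bullet> w = 0 \<Longrightarrow> x \<in> M \<Longrightarrow> y \<in> M \<Longrightarrow> u \<bullet> x = u \<bullet> y" by blast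
    have "D \<subseteq> span {w}"
    proof
      fix z assume "z \<in> D"
      then obtain x where x: "x \<in> M" "z = x - m" by (auto simp: D_def)
      \<comment> \<open>The component of \<open>z\<close> orthogonal to \<open>w\<close>; for
        \<open>w = 0\<close>, division by zero gives \<open>u = z\<close>. It is orthogonal to
        \<open>z\<close> and \<open>w\<close>, hence to itself.\<close>
      define u where "u = z - ((z \<bullet> w) / (w \<bullet> w)) *\<^sub>R w"
      have uw: "u \<bullet> w = 0" by (cases "w = 0") (simp_all add: u_def inner_diff_left)
      have "u \<bullet> z = 0" using w[OF uw x(1) m] x(2) by (simp add: inner_diff_right)
      then have "u \<bullet> u = 0"
        using uw by (simp add: u_def inner_diff_right)
      then have "z = ((z \<bullet> w) / (w \<bullet> w)) *\<^sub>R w" by (simp add: u_def)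
      then show "z \<in> span {w}" unfolding span_singleton by blast
    qed
    then have "dim D \<le> dim {w}" by (metis dim_span dim_subset)
    also have "\<dots> \<le> 1" using dim_le_card'[of "{w}"] by simp
    finally show "aff_dim M \<le> 1" using dim by simp
  qed
qed

text \<open>The gradient map is injective and its range lies between the interior of the sum and the
  sum. The frontier of a convex set is negligible, so a change of variables over the whole space
  gives the volume.\<close>

lemma measure_set_plus_scaled_eq_integral:
  fixes M E :: "(real^'n::{finite,wellorder}) set" and p q :: "nat \<Rightarrow> real^'n::_"
  defines "J \<equiv> \<lambda>t x. det (matrix (\<lambda>v. tilt_cov p x v + t *\<^sub>R tilt_cov q x v))"
  assumes M: "convex M" "compact M" "range p \<subseteq> M" "M \<subseteq> closure (range p)"
    and E: "convex E" "compact E" "range q \<subseteq> E" "E \<subseteq> closure (range q)"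
      "aff_dim E = int CARD('n)"
    and t: "t > 0" and J: "\<And>x. J t x \<ge> 0"
  shows "integrable lebesgue (J t)"
    and "measure lebesgue (M + (\<lambda>x. t *\<^sub>R x) ` E) = integral\<^sup>L lebesgue (J t)"
proof -
  let ?F = "\<lambda>x. tilt_mean p p x + t *\<^sub>R tilt_mean q q x"
  let ?F' = "\<lambda>x v. tilt_cov p x v + t *\<^sub>R tilt_cov q x v"
  let ?S = "M + (\<lambda>x. t *\<^sub>R x) ` E"
  have p: "bounded (range p)" and q: "bounded (range q)"
    using M E bounded_subset compact_imp_bounded by blast+
  have der: "(?F has_derivative ?F' x) (at x)" for x
    by (intro has_derivative_add has_derivative_scaleR_right tilt_mean_has_derivative p q)
  have pos: "v \<bullet> ?F' x v > 0" if "v \<noteq> 0" for v x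
    using tilt_cov_pos[OF E(2-4) _ that, of x] E(5) tilt_cov_nonneg(1)[OF p, of v x] t
    by (simp add: inner_add_right add_nonneg_pos)
  have inj: "inj ?F" by (rule inj_of_positive_derivative[OF der pos])
  have S: "?S \<in> lmeasurable"
    using compact_set_plus_scaled[OF M(2) E(2)] by (rule lmeasurable_compact)
  have "?S - range ?F \<subseteq> frontier ?S"
    using interior_subset_tilt_sum_range[OF M(2-4) E(2-4) t] closure_subset
    by (auto simp: frontier_def)
  moreover have "range ?F - ?S = {}"
    using tilt_sum_range_subset[OF M(1-3) E(1-3)] by blast
  moreover have "negligible (frontier ?S)"
    by (intro negligible_convex_frontier convex_set_plus_scaled M E)
  ultimately have neg: "negligible (?S - range ?F \<union> (range ?F - ?S))"
    using negligible_subset[of "frontier ?S" "?S - range ?F \<union> (range ?F - ?S)"] by blast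
  have range_meas: "range ?F \<in> lmeasurable"
    by (rule lmeasurable_negligible_symdiff[OF S neg])
  have range_eq: "measure lebesgue (range ?F) = measure lebesgue ?S"
    by (rule measure_negligible_symdiff[OF S neg])
  have abs: "(\<lambda>x. \<bar>det (matrix (?F' x))\<bar>) = J t"
    using J by (auto simp: J_def)
  have "J t absolutely_integrable_on UNIV"
    using measurable_differentiable_image_alt[of UNIV ?F ?F'] der inj range_meas
    unfolding abs by simp
  then show int: "integrable lebesgue (J t)"
    by (simp add: set_integrable_def)
  have "((\<lambda>x. \<bar>det (matrix (?F' x))\<bar>) has_integral measure lebesgue (range ?F)) UNIV"
    using has_measure_differentiable_image[of UNIV ?F ?F' "measure lebesgue (range ?F)"] der inj range_meas
    by simp
  then show "measure lebesgue ?S = integral\<^sup>L lebesgue (J t)"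
    using has_integral_integral_lebesgue[OF int] has_integral_unique range_eq unfolding abs by metis
qed

section \<open>The relative Steiner polynomial\<close>

text \<open>The value at \<open>2 * t\<close> minus \<open>2^Suc n\<close> times the value at
  \<open>t\<close> lacks the top coefficient and multiplies the others by nonzero constants, so
  induction applies; \<open>t = 1\<close> recovers the top one.\<close>

lemma integrable_polynomial_coefficients:
  fixes d :: "nat \<Rightarrow> 'b \<Rightarrow> real"
  assumes "\<And>t. t > 0 \<Longrightarrow> integrable N (\<lambda>x. \<Sum>l\<le>n. d l x * t ^ l)"
  shows "l \<le> n \<Longrightarrow> integrable N (d l)"
  using assms
proof (induction n arbitrary: d l)
  case 0
  then show ?case using "0.prems"(2)[of 1] by simp
next
  case (Suc n)
  have low: "integrable N (d l)" if "l \<le> n" for l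
  proof -
    have "integrable N (\<lambda>x. (2^l - 2^Suc n) * d l x)"
    proof (rule Suc.IH[OF that])
      fix t :: real assume t: "t > 0"
      have "integrable N (\<lambda>x. (\<Sum>l\<le>Suc n. d l x * (2 * t) ^ l) - 2^Suc n * (\<Sum>l\<le>Suc n. d l x * t ^ l))"
        using Suc.prems(2)[OF t] Suc.prems(2)[of "2 * t"] t by simp
      also have "(\<lambda>x. (\<Sum>l\<le>Suc n. d l x * (2 * t) ^ l) - 2^Suc n * (\<Sum>l\<le>Suc n. d l x * t ^ l))
        = (\<lambda>x. \<Sum>l\<le>n. ((2^l - 2^Suc n) * d l x) * t ^ l)"
        by (simp add: fun_eq_iff sum_distrib_left sum_subtractf[symmetric] algebra_simps)
      finally show "integrable N (\<lambda>x. \<Sum>l\<le>n. ((2^l - 2^Suc n) * d l x) * t ^ l)" .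
    qed
    moreover have "(2::real)^l - 2^Suc n \<noteq> 0"
      using that by (simp del: power_Suc)
    ultimately show ?thesis by simp
  qed
  have "integrable N (\<lambda>x. (\<Sum>l\<le>Suc n. d l x * 1 ^ l) - (\<Sum>l\<le>n. d l x))"
  proof (rule Bochner_Integration.integrable_diff)
    show "integrable N (\<lambda>x. \<Sum>l\<le>Suc n. d l x * 1 ^ l)"
      using Suc.prems(2)[of 1] by simp
    show "integrable N (\<lambda>x. \<Sum>l\<le>n. d l x)"
      by (intro Bochner_Integration.integrable_sum low) simp
  qed
  then have "integrable N (d (Suc n))" by simp
  then show ?case using low Suc.prems(1) le_Suc_eq by metis
qed

lemma relative_steiner_polynomial_wellorder:
  fixes M E :: "(real^'n::{finite,wellorder}) set"
  assumes "convex_body M" and "convex_body E" and dimE: "aff_dim E = int CARD('n)"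
  shows "\<exists>D :: nat \<Rightarrow> real. (\<forall>l. D l \<ge> 0) \<and>
    (\<forall>t>0. measure lebesgue (M + (\<lambda>x. t *\<^sub>R x) ` E) = (\<Sum>l\<le>CARD('n). D l * t ^ (CARD('n) - l))) \<and>
    (if aff_dim M \<le> 1 then \<forall>l\<ge>2. D l = 0 else D 2 > 0)"
proof -
  have M: "M \<noteq> {}" "convex M" "compact M" and E: "E \<noteq> {}" "convex E" "compact E"
    using assms by (auto simp: convex_body_def)
  obtain p :: "nat \<Rightarrow> real^'n::_" where p: "range p \<subseteq> M" "M \<subseteq> closure (range p)"
    by (rule dense_sequence_exists[OF M(1)]) (rule that)
  obtain q :: "nat \<Rightarrow> real^'n::_" where q: "range q \<subseteq> E" "E \<subseteq> closure (range q)"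
    by (rule dense_sequence_exists[OF E(1)]) (rule that)
  have bp: "bounded (range p)" and bq: "bounded (range q)"
    using p q M E bounded_subset compact_imp_bounded by blast+
  let ?J = "\<lambda>t x. det (matrix (\<lambda>v. tilt_cov p x v + t *\<^sub>R tilt_cov q x v))"
  let ?n = "CARD('n)"
  \<comment> \<open>Degeneracy of the covariance depends on \<open>M\<close> alone, so the same case
    holds at every \<open>x\<close>.\<close>
  have line_iff: "(\<exists>w. \<forall>u. u \<bullet> w = 0 \<longrightarrow> u \<bullet> tilt_cov p x u = 0) \<longleftrightarrow> aff_dim M \<le> 1" for x
    unfolding tilt_cov_nonneg(2)[OF bp] inner_const_on_dense[OF p] aff_dim_le_1_iff[OF M(1)] ..
  have posE: "v \<bullet> tilt_cov q x v > 0" if "v \<noteq> 0" for v x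
    using tilt_cov_pos[OF E(3) q _ that] dimE by simp
  have "\<forall>x. \<exists>d :: nat \<Rightarrow> real. (\<forall>l. d l \<ge> 0) \<and> (\<forall>t. ?J t x = (\<Sum>l\<le>?n. d l * t ^ (?n - l))) \<and>
      (if aff_dim M \<le> 1 then \<forall>l\<ge>2. d l = 0 else d 2 > 0)"
  proof
    fix x
    show "\<exists>d :: nat \<Rightarrow> real. (\<forall>l. d l \<ge> 0) \<and> (\<forall>t. ?J t x = (\<Sum>l\<le>?n. d l * t ^ (?n - l))) \<and>
      (if aff_dim M \<le> 1 then \<forall>l\<ge>2. d l = 0 else d 2 > 0)"
    proof (rule det_pencil_coefficients[of "tilt_cov p x" "tilt_cov q x"])
      fix d :: "nat \<Rightarrow> real"
      assume *: "\<And>l. d l \<ge> 0" "\<And>t. ?J t x = (\<Sum>l\<le>?n. d l * t ^ (?n - l))"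
        "\<exists>w. \<forall>u. u \<bullet> w = 0 \<longrightarrow> u \<bullet> tilt_cov p x u = 0 \<Longrightarrow> \<forall>l\<ge>2. d l = 0"
        "\<nexists>w. \<forall>u. u \<bullet> w = 0 \<longrightarrow> u \<bullet> tilt_cov p x u = 0 \<Longrightarrow> d 2 > 0"
      show ?thesis
        using * unfolding line_iff by (intro exI[of _ d]) auto
    qed (simp_all add: tilt_cov_linear tilt_cov_sym tilt_cov_nonneg(1) posE bp bq)
  qed
  then obtain d :: "real^'n::_ \<Rightarrow> nat \<Rightarrow> real" where d: "\<And>x l. d x l \<ge> 0"
      "\<And>x t. ?J t x = (\<Sum>l\<le>?n. d x l * t ^ (?n - l))"
      "\<And>x. if aff_dim M \<le> 1 then \<forall>l\<ge>2. d x l = 0 else d x 2 > 0"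
    by metis
  have Jpos: "?J t x \<ge> 0" if "t > 0" for t x
    unfolding d(2) using d(1) that by (intro sum_nonneg mult_nonneg_nonneg) auto
  have steiner: "integrable lebesgue (?J t)"
      "measure lebesgue (M + (\<lambda>x. t *\<^sub>R x) ` E) = integral\<^sup>L lebesgue (?J t)" if "t > 0" for t
    using measure_set_plus_scaled_eq_integral[OF M(2,3) p E(2,3) q dimE that] Jpos[OF that] by blast+
  have rev: "(\<Sum>l\<le>?n. d x l * t ^ (?n - l)) = (\<Sum>l\<le>?n. d x (?n - l) * t ^ l)" for x t
    by (rule sum.reindex_bij_witness[of _ "\<lambda>l. ?n - l" "\<lambda>l. ?n - l"]) auto
  have "integrable lebesgue (\<lambda>x. d x (?n - l))" if "l \<le> ?n" for l
    using steiner(1) that unfolding d(2) rev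
    by (intro integrable_polynomial_coefficients[where n = ?n and d = "\<lambda>l x. d x (?n - l)"])
  then have int: "integrable lebesgue (\<lambda>x. d x l)" if "l \<le> ?n" for l
    using that by (metis diff_diff_cancel diff_le_self)
  define D where "D = (\<lambda>l. integral\<^sup>L lebesgue (\<lambda>x. d x l))"
  show ?thesis
  proof (intro exI[of _ D] conjI allI impI)
    \<comment> \<open>No integrability is at hand for \<open>l\<close> above the dimension; there a
      nonexistent integral has the value 0.\<close>
    show "D l \<ge> 0" for l
      unfolding D_def using d(1) by simp
    show "measure lebesgue (M + (\<lambda>x. t *\<^sub>R x) ` E) = (\<Sum>l\<le>?n. D l * t ^ (?n - l))" if "t > 0" for t
      unfolding steiner(2)[OF that] d(2) D_def using int
      by (subst Bochner_Integration.integral_sum) auto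
    show "if aff_dim M \<le> 1 then \<forall>l\<ge>2. D l = 0 else D 2 > 0"
    proof (cases "aff_dim M \<le> 1")
      case True
      then show ?thesis using d(3) by (simp add: D_def)
    next
      case False
      then have d2: "d x 2 > 0" for x using d(3) by simp
      have "2 \<le> ?n" using False aff_dim_le_DIM[of M] by simp
      \<comment> \<open>A positive function with zero integral would make the whole space a null
        set.\<close>
      have "D 2 \<noteq> 0"
      proof
        assume "D 2 = 0"
        then have "AE x in lebesgue. d x 2 = 0"
          using integral_nonneg_eq_0_iff_AE[OF int[OF \<open>2 \<le> ?n\<close>]] d(1) by (simp add: D_def)
        then have "AE x in lebesgue. (x :: real^'n::_) \<in> {}"
          using d2 by (simp add: less_imp_neq[symmetric])
        then have "(UNIV :: (real^'n::_) set) \<in> null_sets lebesgue"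
          by (simp add: AE_iff_null_sets)
        then show False using negligible_iff_null_sets non_negligible_UNIV by blast
      qed
      moreover have "D 2 \<ge> 0" unfolding D_def using d(1) by simp
      ultimately show ?thesis using False by simp
    qed
  qed
qed

text \<open>The change of variables theorem in the library needs a well-ordered index type.\<close>

datatype 'a ordered_copy = Copy (original: 'a)

instance ordered_copy :: (finite) finite
proof
  have "UNIV = range (Copy :: 'a \<Rightarrow> _)" by (metis ordered_copy.exhaust surjI)
  then show "finite (UNIV :: 'a ordered_copy set)" by (metis finite finite_imageI)
qed

text \<open>The order is pulled back along the injection \<open>to_nat\<close> and inherits
  well-foundedness from the natural numbers.\<close>

instantiation ordered_copy :: (finite) wellorder
begin

definition "x \<le> y \<longleftrightarrow> to_nat (original x) \<le> to_nat (original y)"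

definition "x < y \<longleftrightarrow> to_nat (original x) < to_nat (original y)"

instance
proof
  fix P :: "'a ordered_copy \<Rightarrow> bool" and a :: "'a ordered_copy"
  assume step: "\<And>x. (\<And>y. y < x \<Longrightarrow> P y) \<Longrightarrow> P x"
  show "P a"
    by (induction a rule: measure_induct_rule[of "\<lambda>x. to_nat (original x)"])
       (rule step, simp add: less_ordered_copy_def)
qed (auto simp: less_eq_ordered_copy_def less_ordered_copy_def ordered_copy.expand)

end

section \<open>Invariance of volume under relabelling of coordinates\<close>

lemma prod_Basis_cart: "(\<Prod>b\<in>Basis. (x :: real^'n) \<bullet> b) = (\<Prod>i\<in>UNIV. x $ i)"
proof -
  have "Basis = range (\<lambda>i. axis i 1 :: real^'n)"
    by (auto simp: Basis_vec_def)
  then have "(\<Prod>b\<in>Basis. x \<bullet> b) = (\<Prod>b\<in>range (\<lambda>i. axis i 1). x \<bullet> b)"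
    by (simp only:)
  also have "\<dots> = (\<Prod>i\<in>UNIV. x \<bullet> axis i 1)"
    by (subst prod.reindex) (auto intro: injI simp: axis_eq_axis)
  finally show ?thesis by (simp add: inner_axis)
qed

lemma ball_Basis_cart: "(\<forall>b\<in>Basis. P ((x :: real^'n) \<bullet> b) (y \<bullet> b)) \<longleftrightarrow> (\<forall>i. P (x $ i) (y $ i))"
  by (force simp: Basis_vec_def inner_axis)

text \<open>A box pulls back to a box with the same side lengths in another order, and Lebesgue
  measure is determined by boxes.\<close>

lemma lborel_distr_reindex:
  fixes f :: "'m::finite \<Rightarrow> 'n::finite"
  assumes f: "bij f"
  defines "T \<equiv> \<lambda>x :: real^'n. (\<chi> i. x $ f i) :: real^'m"
  shows "distr lborel borel T = lborel"
proof (rule lborel_eqI[symmetric])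
  have "T \<in> borel_measurable borel"
    unfolding T_def
    by (intro borel_measurable_continuous_onI continuous_on_vec_lambda continuous_intros)
  then have meas: "T \<in> borel_measurable lborel" by simp
  fix l u :: "real^'m"
  assume "\<And>b. b \<in> Basis \<Longrightarrow> l \<bullet> b \<le> u \<bullet> b"
  then have lu: "l $ i \<le> u $ i" for i
    using ball_Basis_cart[of "(\<le>)" l u] by simp
  let ?R = "\<lambda>y :: real^'m. (\<chi> j. y $ inv f j) :: real^'n"
  have "T -` box l u = box (?R l) (?R u)"
    using f by (auto simp: T_def mem_box_cart bij_is_inj bij_is_surj surj_f_inv_f) 
       (metis bij_inv_eq_iff)+
  then have "emeasure (distr lborel borel T) (box l u) = emeasure lborel (box (?R l) (?R u))"
    using meas by (simp add: emeasure_distr)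
  also have "\<dots> = (\<Prod>b\<in>Basis. (?R u - ?R l) \<bullet> b)"
    using ball_Basis_cart[of "(\<le>)" "?R l" "?R u"] lu by (intro emeasure_lborel_box) auto
  also have "(\<Prod>b\<in>Basis. (?R u - ?R l) \<bullet> b) = (\<Prod>j\<in>UNIV. (u - l) $ inv f j)"
    by (simp only: prod_Basis_cart) simp
  also have "\<dots> = (\<Prod>i\<in>UNIV. (u - l) $ i)"
    using f by (intro prod.reindex_bij_betw bij_imp_bij_inv)
  finally show "emeasure (distr lborel borel T) (box l u) = (\<Prod>b\<in>Basis. (u - l) \<bullet> b)"
    by (simp only: prod_Basis_cart)
qed simp

lemma measure_reindex_image:
  fixes f :: "'m::finite \<Rightarrow> 'n::finite" and S :: "(real^'n) set"
  assumes f: "bij f" and S: "compact S"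
  shows "measure lebesgue ((\<lambda>x. \<chi> i. x $ f i :: real^'m) ` S) = measure lebesgue S"
proof -
  let ?T = "\<lambda>x :: real^'n. (\<chi> i. x $ f i) :: real^'m"
  have cont: "continuous_on A ?T" for A
    by (intro continuous_on_vec_lambda continuous_intros)
  have "inj ?T"
    using f by (intro injI) (metis (no_types, lifting) bij_pointE vec_eq_iff vec_lambda_beta)
  have TS: "compact (?T ` S)"
    using S cont by (intro compact_continuous_image)
  then have "measure lebesgue (?T ` S) = measure lborel (?T ` S)"
    by (intro measure_completion) (auto intro: borel_compact)
  also have "\<dots> = measure (distr lborel borel ?T) (?T ` S)"
    by (simp only: lborel_distr_reindex[OF f])
  also have "\<dots> = measure lborel (?T -` ?T ` S)"
    using TS cont by (subst measure_distr) (auto intro: borel_compact borel_measurable_continuous_onI)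
  also have "?T -` ?T ` S = S" by (rule inj_vimage_image_eq[OF \<open>inj ?T\<close>])
  also have "measure lborel S = measure lebesgue S"
    using S by (intro measure_completion[symmetric]) (auto intro: borel_compact)
  finally show ?thesis .
qed

text \<open>Relabelling coordinates by \<open>original\<close> preserves volume, dimension and
  Minkowski sums, so the result carries over from the well-ordered index type.\<close>

lemma relative_steiner_polynomial:
  fixes M E :: "(real^'n) set"
  assumes M: "convex_body M" and E: "convex_body E" and dimE: "aff_dim E = int CARD('n)"
  shows "\<exists>D :: nat \<Rightarrow> real. (\<forall>l. D l \<ge> 0) \<and>
    (\<forall>t>0. measure lebesgue (M + (\<lambda>x. t *\<^sub>R x) ` E) = (\<Sum>l\<le>CARD('n). D l * t ^ (CARD('n) - l))) \<and>
    (if aff_dim M \<le> 1 then \<forall>l\<ge>2. D l = 0 else D 2 > 0)"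
proof -
  let ?f = "original :: 'n ordered_copy \<Rightarrow> 'n"
  let ?T = "\<lambda>x :: real^'n. (\<chi> i. x $ ?f i) :: real^('n ordered_copy)"
  have f: "bij ?f"
    by (rule bijI') (auto simp: ordered_copy.expand intro: exI[of _ "Copy _"])
  have lin: "linear ?T"
    by (rule linearI) (simp_all add: vec_eq_iff)
  have inj: "inj ?T"
    using f by (intro injI) (metis (no_types, lifting) bij_pointE vec_eq_iff vec_lambda_beta)
  have body: "convex_body (?T ` K)" if "convex_body K" for K
    using that lin by (auto simp: convex_body_def convex_linear_image linear_continuous_on
        linear_conv_bounded_linear intro: compact_continuous_image)
  have card: "CARD('n ordered_copy) = CARD('n)"
    using bij_betw_same_card[OF f] .
  have dim: "aff_dim (?T ` K) = aff_dim K" for K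
    using aff_dim_injective_linear_image[OF lin inj] .
  have scale: "?T ` (M + (\<lambda>x. t *\<^sub>R x) ` E) = ?T ` M + (\<lambda>x. t *\<^sub>R x) ` (?T ` E)" for t
  proof -
    have "?T (x + t *\<^sub>R y) = ?T x + t *\<^sub>R ?T y" for x y
      by (simp add: vec_eq_iff)
    moreover have "?T ` M \<times> ?T ` E = map_prod ?T ?T ` (M \<times> E)" by auto
    ultimately show ?thesis
      unfolding set_plus_scaled_eq_image
      by (simp only: image_image case_prod_beta fst_map_prod snd_map_prod)
  qed
  have "measure lebesgue (?T ` M + (\<lambda>x. t *\<^sub>R x) ` (?T ` E)) = measure lebesgue (M + (\<lambda>x. t *\<^sub>R x) ` E)" for t
    using M E unfolding scale[symmetric]
    by (intro measure_reindex_image f compact_set_plus_scaled) (auto simp: convex_body_def)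
  then show ?thesis
    using relative_steiner_polynomial_wellorder[OF body[OF M] body[OF E]] dimE
    by (simp only: card dim)
qed

section \<open>Quermassintegrals of \<open>M + E\<close>\<close>

text \<open>For convex \<open>E\<close>, the sum of \<open>E\<close> and \<open>t E\<close> is
  \<open>(1 + t) E\<close>. The factor is positive even at \<open>t = 0\<close>, which matters
  because the polynomial for \<open>M\<close> is known for positive factors only.\<close>

lemma convex_set_plus_scaled_self:
  fixes M E :: "'a::real_vector set"
  assumes "convex E" "t \<ge> 0"
  shows "(M + E) + (\<lambda>x. t *\<^sub>R x) ` E = M + (\<lambda>x. (1 + t) *\<^sub>R x) ` E"
proof -
  have "E + (\<lambda>x. t *\<^sub>R x) ` E = (\<lambda>x. (1 + t) *\<^sub>R x) ` E"
  proof
    show "E + (\<lambda>x. t *\<^sub>R x) ` E \<subseteq> (\<lambda>x. (1 + t) *\<^sub>R x) ` E"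
    proof
      fix z assume "z \<in> E + (\<lambda>x. t *\<^sub>R x) ` E"
      then obtain x y where xy: "x \<in> E" "y \<in> E" "z = x + t *\<^sub>R y"
        by (auto simp: set_plus_def)
      have "(1 / (1 + t)) *\<^sub>R x + (t / (1 + t)) *\<^sub>R y \<in> E"
        using assms xy by (intro convexD) (auto simp: field_simps)
      moreover have "z = (1 + t) *\<^sub>R ((1 / (1 + t)) *\<^sub>R x + (t / (1 + t)) *\<^sub>R y)"
        using assms(2) xy(3) by (simp add: scaleR_add_right)
      ultimately show "z \<in> (\<lambda>x. (1 + t) *\<^sub>R x) ` E" by blast
    qed
    show "(\<lambda>x. (1 + t) *\<^sub>R x) ` E \<subseteq> E + (\<lambda>x. t *\<^sub>R x) ` E"
      by (auto simp: scaleR_add_left intro!: set_plus_intro)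
  qed
  then show ?thesis by (simp add: add.assoc)
qed

text \<open>Both sides count pairs of disjoint subsets of sizes \<open>i\<close> and
  \<open>l\<close> in a set of size \<open>n\<close>; for \<open>i + l > n\<close> both are
  zero.\<close>

lemma binomial_mult_commute:
  assumes "l \<le> n" "i \<le> n"
  shows "(n choose i) * ((n - i) choose l) = (n choose l) * ((n - l) choose i)"
proof (cases "i + l \<le> n")
  case True
  have "(n choose i) * ((n - i) choose l) = (n choose (i + l)) * ((i + l) choose i)"
    using choose_mult[of i "i + l" n] True by simp
  also have "(i + l) choose i = (i + l) choose l"
    using binomial_symmetric[of i "i + l"] by simp
  also have "(n choose (i + l)) * ((i + l) choose l) = (n choose l) * ((n - l) choose i)"
    using choose_mult[of l "i + l" n] True by simp
  finally show ?thesis .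
qed (use assms in \<open>simp add: binomial_eq_0\<close>)

text \<open>The volume polynomial of \<open>M\<close> is evaluated at \<open>1 + t\<close> and
  expanded by the binomial theorem; \<open>binomial_mult_commute\<close> then isolates the factor
  \<open>n choose i\<close> of the Steiner formula.\<close>

lemma steiner_coeffs_shift:
  fixes M E :: "(real^'n) set"
  assumes "convex E"
    and D: "\<And>t. t > 0 \<Longrightarrow>
      measure lebesgue (M + (\<lambda>x. t *\<^sub>R x) ` E) = (\<Sum>l\<le>CARD('n). D l * t ^ (CARD('n) - l))"
  shows "steiner_coeffs (M + E) E (\<lambda>i. if i \<le> CARD('n)
    then \<Sum>l\<le>CARD('n). D l / (CARD('n) choose l) * (CARD('n) - i choose l) else 0)"
proof -
  let ?n = "CARD('n)"
  have "measure lebesgue ((M + E) + (\<lambda>x. t *\<^sub>R x) ` E) =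
      (\<Sum>i\<le>?n. real (?n choose i) * (\<Sum>l\<le>?n. D l / (?n choose l) * (?n - i choose l)) * t ^ i)"
    if t: "t \<ge> 0" for t
  proof -
    have "measure lebesgue ((M + E) + (\<lambda>x. t *\<^sub>R x) ` E) = (\<Sum>l\<le>?n. D l * (t + 1) ^ (?n - l))"
      using D[of "1 + t"] t convex_set_plus_scaled_self[OF assms(1) t, of M] by (simp add: add.commute)
    also have "\<dots> = (\<Sum>l\<le>?n. D l * (\<Sum>i\<le>?n. real (?n - l choose i) * t ^ i))"
    proof (rule sum.cong[OF refl])
      fix l
      have "(t + 1) ^ (?n - l) = (\<Sum>i\<le>?n - l. real (?n - l choose i) * t ^ i)"
        by (simp add: binomial_ring)
      also have "\<dots> = (\<Sum>i\<le>?n. real (?n - l choose i) * t ^ i)"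
        by (rule sum.mono_neutral_left) auto
      finally show "D l * (t + 1) ^ (?n - l) = D l * (\<Sum>i\<le>?n. real (?n - l choose i) * t ^ i)"
        by simp
    qed
    also have "\<dots> = (\<Sum>l\<le>?n. \<Sum>i\<le>?n. D l * real (?n - l choose i) * t ^ i)"
      by (simp add: sum_distrib_left mult.assoc)
    also have "\<dots> = (\<Sum>i\<le>?n. \<Sum>l\<le>?n. D l * real (?n - l choose i) * t ^ i)"
      by (rule sum.swap)
    also have "\<dots> = (\<Sum>i\<le>?n. real (?n choose i) * (\<Sum>l\<le>?n. D l / (?n choose l) * (?n - i choose l)) * t ^ i)"
      unfolding sum_distrib_left sum_distrib_right
    proof (intro sum.cong[OF refl])
      fix i l assume "i \<in> {..?n}" "l \<in> {..?n}"
      then have "real (?n choose i) * real (?n - i choose l) = real (?n choose l) * real (?n - l choose i)"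
        and "real (?n choose l) \<noteq> 0"
        using binomial_mult_commute[of l ?n i] by (auto simp flip: of_nat_mult)
      then show "D l * real (?n - l choose i) * t ^ i =
          real (?n choose i) * (D l / (?n choose l) * (?n - i choose l)) * t ^ i"
        by (simp add: field_simps)
    qed
    finally show ?thesis .
  qed
  then show ?thesis by (simp add: steiner_coeffs_def)
qed

text \<open>By Pascal's rule a unit step from \<open>x\<close> raises \<open>x choose Suc l\<close>
  by \<open>x choose l\<close>, which is nondecreasing: each of the \<open>d\<close> steps from
  \<open>b\<close> gains at least \<open>b choose l\<close>.\<close>

lemma binomial_add_lower: "(b choose Suc l) + d * (b choose l) \<le> (b + d) choose Suc l"
proof (induction d)
  case (Suc d)
  have "b choose l \<le> (b + d) choose l" by (simp add: binomial_right_mono)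
  with Suc show ?case by simp
qed simp

text \<open>Each of the \<open>Suc d\<close> steps from \<open>c\<close> gains at most the last
  increment, taken at \<open>c + d\<close>.\<close>

lemma binomial_add_upper: "(c + Suc d) choose Suc l \<le> (c choose Suc l) + Suc d * ((c + d) choose l)"
proof (induction d)
  case (Suc d)
  have "(c + d) choose l \<le> (c + Suc d) choose l" by (simp add: binomial_right_mono)
  then have "Suc d * ((c + d) choose l) \<le> Suc d * ((c + Suc d) choose l)" by (rule mult_le_mono2)
  with Suc show ?case by simp
qed simp

text \<open>Up to a positive factor, \<open>\<Delta> l\<close> is the slope over
  \<open>[b, a]\<close> minus the slope over \<open>[c, b]\<close>. For \<open>l = Suc m\<close> the
  first is at least \<open>b choose m\<close>, the second at most
  \<open>(b - 1) choose m\<close>.\<close>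

lemma binomial_convex:
  fixes a b c :: nat
  assumes "c < b" "b < a"
  defines "\<Delta> \<equiv> \<lambda>l. (real b - real c) * (a choose l) - (real a - real c) * (b choose l)
    + (real a - real b) * (c choose l)"
  shows "\<Delta> l \<ge> 0" and "l \<le> 1 \<Longrightarrow> \<Delta> l = 0" and "\<Delta> 2 > 0"
proof -
  obtain d where d: "a = b + Suc d" using assms(2) less_imp_Suc_add by auto
  obtain e where e: "b = c + Suc e" using assms(1) less_imp_Suc_add by auto
  have lower: "\<Delta> (Suc m) \<ge> (1 + real d) * (1 + real e) * (real (b choose m) - real ((b - 1) choose m))" for m
  proof -
    have "real ((b choose Suc m) + Suc d * (b choose m)) \<le> real (a choose Suc m)"
      unfolding d of_nat_le_iff by (rule binomial_add_lower)
    then have 1: "(1 + real e) * (real (b choose Suc m) + (1 + real d) * real (b choose m))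
        \<le> (1 + real e) * real (a choose Suc m)"
      by (intro mult_left_mono) (auto simp: algebra_simps)
    have "real (b choose Suc m) \<le> real ((c choose Suc m) + Suc e * ((b - 1) choose m))"
      unfolding of_nat_le_iff using binomial_add_upper[of c e m] by (simp add: e)
    then have 2: "(1 + real d) * real (b choose Suc m)
        \<le> (1 + real d) * (real (c choose Suc m) + (1 + real e) * real ((b - 1) choose m))"
      by (intro mult_left_mono) (auto simp: algebra_simps)
    have "real b - real c = 1 + real e" "real a - real b = 1 + real d" "real a - real c = 2 + real d + real e"
      by (simp_all add: d e)
    then show ?thesis using 1 2 by (simp add: \<Delta>_def algebra_simps)
  qed
  show small: "\<Delta> l = 0" if "l \<le> 1"
  proof -
    have "l = 0 \<or> l = 1" using that by auto
    then show ?thesis by (auto simp: \<Delta>_def algebra_simps)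
  qed
  show "\<Delta> l \<ge> 0"
  proof (cases l)
    case 0
    then show ?thesis using small by simp
  next
    case (Suc m)
    have "real ((b - 1) choose m) \<le> real (b choose m)"
      by (simp add: binomial_right_mono)
    then have "(1 + real d) * (1 + real e) * (real (b choose m) - real ((b - 1) choose m)) \<ge> 0"
      by (intro mult_nonneg_nonneg) auto
    then show ?thesis unfolding Suc using lower[of m] by (rule order_trans)
  qed
  \<comment> \<open>For \<open>l = 2\<close> the two slope bounds differ by exactly 1;
    \<open>b\<close> is positive, so \<open>b - 1\<close> is not truncated.\<close>
  have "\<Delta> (Suc 1) \<ge> (1 + real d) * (1 + real e) * (real (b choose 1) - real ((b - 1) choose 1))"
    by (rule lower)
  also have "real (b choose 1) - real ((b - 1) choose 1) = 1" by (simp add: e)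
  finally have "\<Delta> (Suc 1) \<ge> (1 + real d) * (1 + real e)" by simp
  moreover have "(1 + real d) * (1 + real e) > 0" by (intro mult_pos_pos) auto
  ultimately have "\<Delta> (Suc 1) > 0" by (rule less_le_trans[rotated])
  then show "\<Delta> 2 > 0" by (simp add: numeral_2_eq_2)
qed

theorem theorem1p1:
  fixes M E K :: "(real ^ 'n) set" and i j k :: nat
  assumes "convex_body M" and "convex_body E"
    and "aff_dim E = int CARD('n)"
    and "K = M + E"
    and "i < j" and "j < k" and "k \<le> CARD('n)"
  shows "(real k - real j) * quermass i K E + (real i - real k) * quermass j K E
           + (real j - real i) * quermass k K E \<ge> 0
       \<and> ((real k - real j) * quermass i K E + (real i - real k) * quermass j K E
           + (real j - real i) * quermass k K E = 0 \<longleftrightarrow> aff_dim M \<le> 1)"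
proof -
  let ?n = "CARD('n)"
  obtain D :: "nat \<Rightarrow> real" where D: "\<And>l. D l \<ge> 0"
    and vol: "\<And>t. t > 0 \<Longrightarrow>
      measure lebesgue (M + (\<lambda>x. t *\<^sub>R x) ` E) = (\<Sum>l\<le>?n. D l * t ^ (?n - l))"
    and line: "if aff_dim M \<le> 1 then \<forall>l\<ge>2. D l = 0 else D 2 > 0"
    using relative_steiner_polynomial[OF assms(1-3)] by blast
  define w where "w = (\<lambda>m. if m \<le> ?n
    then \<Sum>l\<le>?n. D l / (?n choose l) * (?n - m choose l) else 0)"
  have "steiner_coeffs K E w"
    unfolding w_def assms(4)
    using assms(2) vol by (intro steiner_coeffs_shift) (auto simp: convex_body_def)
  then have "(THE w. steiner_coeffs K E w) = w"
    using steiner_coeffs_unique by blast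
  then have quermass: "quermass m K E = (\<Sum>l\<le>?n. D l / (?n choose l) * (?n - m choose l))" if "m \<le> ?n" for m
    using that by (simp add: quermass_def w_def)
  \<comment> \<open>The function of \<open>binomial_convex\<close> at \<open>?n - i\<close>,
    \<open>?n - j\<close> and \<open>?n - k\<close>; its coefficients are the differences of
    \<open>i\<close>, \<open>j\<close> and \<open>k\<close>.\<close>
  define \<Delta> where "\<Delta> = (\<lambda>l. (real (?n - j) - real (?n - k)) * (?n - i choose l)
    - (real (?n - i) - real (?n - k)) * (?n - j choose l)
    + (real (?n - i) - real (?n - j)) * (?n - k choose l))"
  have "?n - k < ?n - j" "?n - j < ?n - i" using assms(5-7) by auto
  note conv = binomial_convex[OF this]
  have \<Delta>: "\<Delta> l \<ge> 0" "l \<le> 1 \<Longrightarrow> \<Delta> l = 0" "\<Delta> 2 > 0" for l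
    unfolding \<Delta>_def by (rule conv(1), erule conv(2), rule conv(3))
  define W where "W = (real k - real j) * quermass i K E + (real i - real k) * quermass j K E
           + (real j - real i) * quermass k K E"
  define c where "c = (\<lambda>l. D l / (?n choose l))"
  have "W = (\<Sum>l\<le>?n. (real k - real j) * (c l * (?n - i choose l))
      + (real i - real k) * (c l * (?n - j choose l)) + (real j - real i) * (c l * (?n - k choose l)))"
    using assms(5-7) by (simp add: W_def quermass c_def sum_distrib_left sum.distrib)
  also have "\<dots> = (\<Sum>l\<le>?n. c l * \<Delta> l)"
    using assms(5-7) by (intro sum.cong) (simp_all add: \<Delta>_def of_nat_diff algebra_simps)
  finally have W: "W = (\<Sum>l\<le>?n. D l / (?n choose l) * \<Delta> l)"
    by (simp only: c_def)
  have nonneg: "D l / (?n choose l) * \<Delta> l \<ge> 0" for l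
    using D \<Delta>(1) by (intro mult_nonneg_nonneg) auto
  have "W \<ge> 0" unfolding W using nonneg by (rule sum_nonneg)
  moreover have "W = 0 \<longleftrightarrow> aff_dim M \<le> 1"
  proof (cases "aff_dim M \<le> 1")
    case True
    \<comment> \<open>Terms with \<open>l \<le> 1\<close> vanish because \<open>\<Delta> l\<close>
      does, the others because \<open>D l\<close> does.\<close>
    have "D l / (?n choose l) * \<Delta> l = 0" for l
      using True line \<Delta>(2)[of l] by (cases "l \<le> 1") auto
    then have "W = 0" unfolding W by (intro sum.neutral) blast
    then show ?thesis using True by simp
  next
    case False
    \<comment> \<open>Three distinct indices up to the dimension force it to be at least 2, so the
      sum contains the positive term at \<open>l = 2\<close>, which bounds \<open>W\<close> from
      below.\<close>
    have "2 \<le> ?n" using assms(5-7) by simp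
    have "0 < D 2 / (?n choose 2) * \<Delta> 2"
      using False line \<Delta>(3) \<open>2 \<le> ?n\<close> by (intro mult_pos_pos divide_pos_pos) auto
    also have "\<dots> \<le> W"
      unfolding W using nonneg \<open>2 \<le> ?n\<close> by (intro member_le_sum) auto
    finally show ?thesis using False by simp
  qed
  ultimately show ?thesis unfolding W_def by blast
qed

end
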